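(* Let $m\in\mathbb{N}$ and let $\mathcal{P}=\{\boldsymbol{y}_0,\ldots,\boldsymbol{y}_{2^m-1}\}$ be a projection regular $2^m$-element point set in $[0,1)^s$. Let $1\le p,q\le\infty$ be such that $\frac1p+\frac1q=1$. Then $$\mathrm{wce}(\mathcal{P};p,s,\boldsymbol{\gamma},\varphi)\le\left(\sum_{\emptyset\neq\mathfrak{u}\subseteq[s]}\gamma_{\mathfrak{u}}^q\prod_{i\in\mathfrak{u}}(b_i-a_i)^q\left(\frac{2^{|\mathfrak{u}|}}{2^m}+E(\mathcal{P},\mathfrak{u})\right)^q\right)^{1/q}$$ (for $q=\infty$ the right-hand side is the maximum over $\emptyset\ne\mathfrak{u}\subseteq[s]$ of $\gamma_{\mathfrak{u}}\prod_{i\in\mathfrak{u}}(b_i-a_i)\,(2^{|\mathfrak{u}|}2^{-m}+E(\mathcal{P},\mathfrak{u}))$), where $$E(\mathcal{P},\mathfrak{u}):=\sum_{\boldsymbol{k}_{\mathfrak{u}}\in\{1,\ldots,2^m-1\}^{|\mathfrak{u}|}}\frac{1}{2^{\mu(\boldsymbol{k}_{\mathfrak{u}})}}\left|\frac1{2^m}\sum_{n=0}^{2^m-1}\mathrm{wal}_{\boldsymbol{k}_{\mathfrak{u}}}(\boldsymbol{y}_{n,\mathfrak{u}})\right|.$$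
   Context: Setting. Let $s\in\mathbb{N}$, $[s]=\{1,\ldots,s\}$, $-\infty<a_i<b_i<\infty$ for $i\in[s]$, $[\boldsymbol a,\boldsymbol b]=\prod_{i=1}^s[a_i,b_i]$. For each $i$ let $\varphi_i:[a_i,b_i]\to\mathbb{R}$ be a probability density function with respect to Lebesgue measure, $\varphi(\boldsymbol x)=\prod_{i=1}^s\varphi_i(x_i)$, and let $\Phi_i(x)=\int_{a_i}^x\varphi_i(y)\,\mathrm{d}y$, which is assumed to be invertible as a map $[a_i,b_i]\to[0,1]$. Put $\Phi^{-1}(\boldsymbol x)=(\Phi_1^{-1}(x_1),\ldots,\Phi_s^{-1}(x_s))$ for $\boldsymbol x\in[0,1]^s$. Let $\boldsymbol\gamma=\{\gamma_{\mathfrak u}:\mathfrak u\subseteq[s]\}$ be positive real numbers (weights). Norm. For $\mathfrak u=\{u_1<\cdots<u_k\}\subseteq[s]$ let $\frac{\partial^{|\mathfrak u|}F}{\partial\boldsymbol x_{\mathfrak u}}=\frac{\partial^kF}{\partial x_{u_1}\cdots\partial x_{u_k}}$ (equal to $F$ for $\mathfrak u=\emptyset$). For functions $F:[\boldsymbol a,\boldsymbol b]\to\mathbb{R}$ for which these mixed partial derivatives exist, and $p\in[1,\infty]$, let $\|F\|_{p,s,\boldsymbol\gamma}=\left(\sum_{\mathfrak u\subseteq[s]}\left(\frac1{\gamma_{\mathfrak u}}\sup_{\boldsymbol x\in[\boldsymbol a,\boldsymbol b]}\left|\frac{\partial^{|\mathfrak u|}F}{\partial\boldsymbol x_{\mathfrak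 u}}(\boldsymbol x)\right|\right)^p\right)^{1/p}$, with the maximum over $\mathfrak u$ if $p=\infty$. Worst-case error. For points $\mathcal P=\{\boldsymbol y_0,\ldots,\boldsymbol y_{N-1}\}$ in $[0,1]^s$ let $\mathrm{err}(F;\varphi;\mathcal P)=\frac1N\sum_{n=0}^{N-1}F(\Phi^{-1}(\boldsymbol y_n))-\int_{[\boldsymbol a,\boldsymbol b]}F(\boldsymbol x)\varphi(\boldsymbol x)\,\mathrm d\boldsymbol x$ and $\mathrm{wce}(\mathcal P;p,s,\boldsymbol\gamma,\varphi)=\sup_{\|F\|_{p,s,\boldsymbol\gamma}\le1}|\mathrm{err}(F;\varphi;\mathcal P)|$. Projection regular. A $2^m$-element point set $\{\boldsymbol x_0,\ldots,\boldsymbol x_{2^m-1}\}$ in $[0,1)^s$, $\boldsymbol x_n=(x_{n,1},\ldots,x_{n,s})$, is projection regular if for every $i\in[s]$ and every $a\in\{0,\ldots,2^m-1\}$ the interval $[\frac a{2^m},\frac{a+1}{2^m})$ contains exactly one of the numbers $x_{0,i},\ldots,x_{2^m-1,i}$. Walsh functions. For $x\in[0,1)$ with dyadic expansion $x=\frac{\xi_1}2+\frac{\xi_2}{2^2}+\cdots$ (infinitely many digits different from $1$) and $k=\kappa_0+\kappa_12+\cdots+\kappa_{r-1}2^{r-1}\in\mathbb{N}_0$ with $\kappa_j\in\{0,1\}$, $\mathrm{wal}_k(x)=(-1)^{\kappa_0\xi_1+\cdots+\kappa_{r-1}\xi_r}$. For $\mathfrak u\subseteq[s]$, $\boldsymbol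 k_{\mathfrak u}=(k_i)_{i\in\mathfrak u}$ and $\boldsymbol y_{\mathfrak u}=(y_i)_{i\in\mathfrak u}$ (the projection of $\boldsymbol y$ to the components in $\mathfrak u$), $\mathrm{wal}_{\boldsymbol k_{\mathfrak u}}(\boldsymbol y_{\mathfrak u})=\prod_{i\in\mathfrak u}\mathrm{wal}_{k_i}(y_i)$; $\boldsymbol y_{n,\mathfrak u}$ is the projection of $\boldsymbol y_n$. The function $\mu$. $\mu(0)=0$ and $\mu(k)=l$ if $2^{l-1}\le k<2^l$; $\mu(\boldsymbol k_{\mathfrak u})=\sum_{i\in\mathfrak u}\mu(k_i)$. *)

theory Defs
  imports "HOL-Analysis.Analysis"
begin

text \<open>
  Points of \<open>s\<close>-dimensional space are functions \<open>nat \<Rightarrow> real\<close> that are extensional on \<open>{1..s}\<close>.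
  The parameters \<open>a b\<close> are the corners of the box and \<open>f i\<close> is the density \<open>\<phi>\<^sub>i\<close>.
\<close>

definition box_on :: "nat \<Rightarrow> (nat \<Rightarrow> real) \<Rightarrow> (nat \<Rightarrow> real) \<Rightarrow> (nat \<Rightarrow> real) set" where
  "box_on s a b = (\<Pi>\<^sub>E i\<in>{1..s}. {a i..b i})"

definition prob_density_on :: "real \<Rightarrow> real \<Rightarrow> (real \<Rightarrow> real) \<Rightarrow> bool" where
  "prob_density_on l u g \<longleftrightarrow>
     (\<forall>x\<in>{l..u}. 0 \<le> g x) \<and> set_integrable lebesgue {l..u} g \<and> (LINT x:{l..u}|lebesgue. g x) = 1"

definition cdf_on :: "real \<Rightarrow> (real \<Rightarrow> real) \<Rightarrow> real \<Rightarrow> real" where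
  "cdf_on l g x = (LINT y:{l..x}|lebesgue. g y)"

definition inv_cdf :: "nat \<Rightarrow> (nat \<Rightarrow> real) \<Rightarrow> (nat \<Rightarrow> real) \<Rightarrow> (nat \<Rightarrow> real \<Rightarrow> real) \<Rightarrow>
    (nat \<Rightarrow> real) \<Rightarrow> (nat \<Rightarrow> real)" where
  "inv_cdf s a b f x = (\<lambda>i\<in>{1..s}. inv_into {a i..b i} (cdf_on (a i) (f i)) (x i))"

text \<open>
  Derivatives are taken within \<open>{a i..b i}\<close> (one-sided at the end points), so only the values of
  \<open>F\<close> on the box matter.
\<close>

definition partial_deriv :: "(nat \<Rightarrow> real) \<Rightarrow> (nat \<Rightarrow> real) \<Rightarrow> nat \<Rightarrow>
    ((nat \<Rightarrow> real) \<Rightarrow> real) \<Rightarrow> ((nat \<Rightarrow> real) \<Rightarrow> real)" where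
  "partial_deriv a b i F = (\<lambda>x. vector_derivative (\<lambda>t. F (x(i := t))) (at (x i) within {a i..b i}))"

text \<open>For \<open>u = {u\<^sub>1 < \<dots> < u\<^sub>k}\<close> the outermost derivative is the one with respect to \<open>u\<^sub>1\<close>.\<close>

definition mixed_partial :: "(nat \<Rightarrow> real) \<Rightarrow> (nat \<Rightarrow> real) \<Rightarrow> nat set \<Rightarrow>
    ((nat \<Rightarrow> real) \<Rightarrow> real) \<Rightarrow> ((nat \<Rightarrow> real) \<Rightarrow> real)" where
  "mixed_partial a b u F = foldr (partial_deriv a b) (sorted_list_of_set u) F"

text \<open>
  Only the outermost differentiation is mentioned for each \<open>u\<close>; the inner ones are those of the
  subsets \<open>u - {Min u}\<close> and so on.
\<close>

definition has_mixed_partials :: "nat \<Rightarrow> (nat \<Rightarrow> real) \<Rightarrow> (nat \<Rightarrow> real) \<Rightarrow>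
    ((nat \<Rightarrow> real) \<Rightarrow> real) \<Rightarrow> bool" where
  "has_mixed_partials s a b F \<longleftrightarrow>
     (\<forall>u. u \<subseteq> {1..s} \<and> u \<noteq> {} \<longrightarrow> (\<forall>x\<in>box_on s a b.
        (\<lambda>t. mixed_partial a b (u - {Min u}) F (x(Min u := t)))
          differentiable (at (x (Min u)) within {a (Min u)..b (Min u)})))"

definition sup_mixed_partial :: "nat \<Rightarrow> (nat \<Rightarrow> real) \<Rightarrow> (nat \<Rightarrow> real) \<Rightarrow> nat set \<Rightarrow>
    ((nat \<Rightarrow> real) \<Rightarrow> real) \<Rightarrow> real" where
  "sup_mixed_partial s a b u F = (SUP x\<in>box_on s a b. \<bar>mixed_partial a b u F x\<bar>)"

text \<open>The norm is infinite as soon as one of the suprema is; otherwise they are real suprema.\<close>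

definition mixed_norm :: "ereal \<Rightarrow> nat \<Rightarrow> (nat set \<Rightarrow> real) \<Rightarrow> (nat \<Rightarrow> real) \<Rightarrow> (nat \<Rightarrow> real) \<Rightarrow>
    ((nat \<Rightarrow> real) \<Rightarrow> real) \<Rightarrow> ereal" where
  "mixed_norm p s \<gamma> a b F =
    (if \<exists>u\<subseteq>{1..s}. \<not> bdd_above ((\<lambda>x. \<bar>mixed_partial a b u F x\<bar>) ` box_on s a b) then \<infinity>
     else if p = \<infinity> then ereal (MAX u\<in>Pow {1..s}. 1 / \<gamma> u * sup_mixed_partial s a b u F)
     else ereal ((\<Sum>u\<in>Pow {1..s}. (1 / \<gamma> u * sup_mixed_partial s a b u F) powr real_of_ereal p)
                   powr (1 / real_of_ereal p)))"

text \<open>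
  The factors of the product measure carry the Lebesgue sigma-algebra, so that the densities need
  only be Lebesgue measurable.
\<close>

definition qmc_err :: "nat \<Rightarrow> (nat \<Rightarrow> real) \<Rightarrow> (nat \<Rightarrow> real) \<Rightarrow> (nat \<Rightarrow> real \<Rightarrow> real) \<Rightarrow> nat \<Rightarrow>
    (nat \<Rightarrow> nat \<Rightarrow> real) \<Rightarrow> ((nat \<Rightarrow> real) \<Rightarrow> real) \<Rightarrow> real" where
  "qmc_err s a b f N y F =
     1 / real N * (\<Sum>n<N. F (inv_cdf s a b f (y n)))
     - (LINT x:box_on s a b|PiM {1..s} (\<lambda>_. lebesgue). F x * (\<Prod>i\<in>{1..s}. f i (x i)))"

definition wce :: "nat \<Rightarrow> (nat \<Rightarrow> nat \<Rightarrow> real) \<Rightarrow> ereal \<Rightarrow> nat \<Rightarrow> (nat set \<Rightarrow> real) \<Rightarrow>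
    (nat \<Rightarrow> real) \<Rightarrow> (nat \<Rightarrow> real) \<Rightarrow> (nat \<Rightarrow> real \<Rightarrow> real) \<Rightarrow> ereal" where
  "wce N y p s \<gamma> a b f =
     (SUP F\<in>{F. has_mixed_partials s a b F \<and> mixed_norm p s \<gamma> a b F \<le> 1}.
        ereal \<bar>qmc_err s a b f N y F\<bar>)"

definition projection_regular :: "nat \<Rightarrow> nat \<Rightarrow> (nat \<Rightarrow> nat \<Rightarrow> real) \<Rightarrow> bool" where
  "projection_regular s m y \<longleftrightarrow>
     inj_on y {..<2 ^ m} \<and> (\<forall>n<2 ^ m. y n \<in> (\<Pi>\<^sub>E i\<in>{1..s}. {0..<1})) \<and>
     (\<forall>i\<in>{1..s}. \<forall>c::nat. c < 2 ^ m \<longrightarrow>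
        (\<exists>!n. n < 2 ^ m \<and> y n i \<in> {real c / 2 ^ m..<(real c + 1) / 2 ^ m}))"

text \<open>Digits are indexed from 0: \<open>dyadic_digits x j\<close> is \<open>\<xi>\<^sub>j\<^sub>+\<^sub>1\<close>.\<close>

definition dyadic_digits :: "real \<Rightarrow> nat \<Rightarrow> nat" where
  "dyadic_digits x = (THE \<xi>. (\<forall>j. \<xi> j \<in> {0, 1}) \<and> infinite {j. \<xi> j \<noteq> 1} \<and>
                             (\<lambda>j. real (\<xi> j) / 2 ^ (j + 1)) sums x)"

definition mu :: "nat \<Rightarrow> nat" where
  "mu k = (if k = 0 then 0 else (THE l. 2 ^ (l - 1) \<le> k \<and> k < 2 ^ l))"

text \<open>\<open>mu k\<close> is the number of binary digits of \<open>k\<close>, and \<open>k div 2 ^ j mod 2\<close> is \<open>\<kappa>\<^sub>j\<close>.\<close>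

definition wal :: "nat \<Rightarrow> real \<Rightarrow> real" where
  "wal k x = (-1) ^ (\<Sum>j<mu k. (k div 2 ^ j mod 2) * dyadic_digits x j)"

definition walsh_sum :: "nat \<Rightarrow> (nat \<Rightarrow> nat \<Rightarrow> real) \<Rightarrow> nat set \<Rightarrow> real" where
  "walsh_sum m y u =
     (\<Sum>k\<in>(\<Pi>\<^sub>E i\<in>u. {1..2 ^ m - 1}).
        1 / 2 ^ (\<Sum>i\<in>u. mu (k i)) * \<bar>1 / 2 ^ m * (\<Sum>n<2 ^ m. \<Prod>i\<in>u. wal (k i) (y n i))\<bar>)"

end

theory Submission
  imports Defs
begin

text \<open>
  Expanding \<open>\<Prod>\<^sub>i P\<^sub>i = \<Prod>\<^sub>i ((P\<^sub>i - I\<^sub>i) + I\<^sub>i)\<close>, where \<open>P\<^sub>i\<close> is evaluation and \<open>I\<^sub>i\<close> integration against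
  \<open>\<phi>\<^sub>i\<close> in the \<open>i\<close>-th coordinate, splits the error into components indexed by \<open>u \<noteq> {}\<close>. Integrating by
  parts in the coordinates of \<open>u\<close> bounds the component \<open>u\<close> by
  \<open>\<Prod>\<^bsub>i\<in>u\<^esub> (b\<^sub>i - a\<^sub>i) \<cdot> sup \<bar>\<partial>\<^sub>u F\<bar>\<close> times the supremum over \<open>t\<close> of
  \<open>D\<^sub>u(t) = \<bar>mean\<^sub>n \<Prod>\<^bsub>i\<in>u\<^esub> (1[y\<^sub>n\<^sub>i \<le> t\<^sub>i] - t\<^sub>i)\<bar>\<close>. For \<open>t\<close> on the grid of multiples of \<open>1 / 2 ^ m\<close> each factor is a Walsh polynomial
  without constant term whose \<open>k\<close>-th coefficient is at most \<open>1 / 2 ^ mu k\<close>, so \<open>D\<^sub>u(t) \<le> E(P, u)\<close>; rounding a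
  general \<open>t\<close> down to the grid costs at most \<open>2 * card u / 2 ^ m \<le> 2 ^ card u / 2 ^ m\<close> by projection regularity. Hoelder's
  inequality concludes.

  The mixed partial derivatives need not be continuous, so the integration by parts is done discretely:
  \<open>F\<close> is replaced by its values on a uniform grid, mixed differences are bounded by an iterated mean
  value argument, and the mesh tends to 0.
\<close>

section \<open>Walsh functions on dyadic cells\<close>

text \<open>The value of \<open>wal k\<close> on the cell from \<open>A / 2 ^ m\<close> to
  \<open>(A + 1) / 2 ^ m\<close>, for \<open>k < 2 ^ m\<close>: digit \<open>j\<close> of a point of
  the cell, counted from 0, is bit \<open>m - 1 - j\<close> of the cell number
  \<open>A\<close>.\<close>

definition walsh_kernel :: "nat \<Rightarrow> nat \<Rightarrow> nat \<Rightarrow> real" where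
  "walsh_kernel m k A = (\<Prod>j<m. (-1) ^ ((k div 2 ^ j mod 2) * (A div 2 ^ (m - 1 - j) mod 2)))"

lemma sum_lessThan_power_Suc:
  fixes g :: "nat \<Rightarrow> real"
  shows "(\<Sum>k<2 ^ Suc m. g k) = (\<Sum>k<2 ^ m. g k) + (\<Sum>k<2 ^ m. g (2 ^ m + k))"
proof -
  have "(\<Sum>k<2 ^ Suc m. g k) = (\<Sum>k\<in>{0..<2 ^ m}. g k) + (\<Sum>k\<in>{2 ^ m..<2 ^ m + 2 ^ m}. g k)"
    by (simp add: lessThan_atLeast0 mult_2 sum.atLeastLessThan_concat)
  also have "(\<Sum>k\<in>{2 ^ m..<2 ^ m + 2 ^ m}. g k) = (\<Sum>k\<in>{0..<2 ^ m}. g (2 ^ m + k))"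
    using sum.shift_bounds_nat_ivl[of g 0 "2^m" "2^m"] by (simp add: add.commute)
  finally show ?thesis by (simp add: lessThan_atLeast0)
qed

text \<open>The top bit \<open>e\<close> of the frequency meets the lowest bit of the cell number;
  the other bits only see the coarser cell \<open>A div 2\<close>. The inductions for orthogonality
  and for partial sums both rest on this recursion.\<close>

lemma walsh_kernel_Suc:
  assumes "k < 2 ^ m" "e \<le> 1"
  shows "walsh_kernel (Suc m) (2 ^ m * e + k) A = walsh_kernel m k (A div 2) * (-1) ^ (e * (A mod 2))"
proof -
  have dig: "(2 ^ m * e + k) div 2 ^ j mod 2 = k div 2 ^ j mod 2" if "j < m" for j
  proof -
    obtain d where d: "m = j + Suc d" using \<open>j < m\<close> less_imp_Suc_add by auto
    have "(2 ^ m * e + k) div 2 ^ j = 2 * (2 ^ d * e) + k div 2 ^ j"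
      unfolding d power_add by (simp add: div_add1_eq mult.assoc)
    then show ?thesis by simp
  qed
  have "(2 ^ m * e + k) div 2 ^ m mod 2 = e" using assms by simp
  moreover have "A div 2 ^ (m - j) = A div 2 div 2 ^ (m - 1 - j)" if "j < m" for j
  proof -
    have "m - j = Suc (m - 1 - j)" using that by simp
    then show ?thesis by (simp add: div_mult2_eq)
  qed
  ultimately show ?thesis unfolding walsh_kernel_def
    by (simp add: dig)
qed

lemma walsh_kernel_abs: "\<bar>walsh_kernel m k A\<bar> = 1"
  by (simp add: walsh_kernel_def abs_prod power_abs)

text \<open>Orthogonality with the sum over frequencies rather than cells. Splitting off the top bit
  of \<open>k\<close> yields the factor \<open>1 + (-1) ^ (A mod 2 + B mod 2)\<close>, which
  vanishes if the last bits differ; the induction hypothesis compares the remaining bits.\<close>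

lemma walsh_kernel_orthogonal:
  assumes "A < 2 ^ m" "B < 2 ^ m"
  shows "(\<Sum>k<2 ^ m. walsh_kernel m k A * walsh_kernel m k B) = (if A = B then 2 ^ m else 0)"
  using assms
proof (induction m arbitrary: A B)
  case 0
  then show ?case by (simp add: walsh_kernel_def)
next
  case (Suc m)
  let ?w = "\<lambda>k. walsh_kernel m k (A div 2) * walsh_kernel m k (B div 2)"
  have IH: "(\<Sum>k<2 ^ m. ?w k) = (if A div 2 = B div 2 then 2 ^ m else 0)"
    by (rule Suc.IH) (use Suc.prems in auto)
  have low: "walsh_kernel (Suc m) k C = walsh_kernel m k (C div 2)" if "k < 2 ^ m" for k C
    using walsh_kernel_Suc[OF that, of 0 C] by simp
  have high: "walsh_kernel (Suc m) (2 ^ m + k) C = walsh_kernel m k (C div 2) * (-1) ^ (C mod 2)"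
    if "k < 2 ^ m" for k C
    using walsh_kernel_Suc[OF that, of 1 C] by simp
  have "(\<Sum>k<2 ^ Suc m. walsh_kernel (Suc m) k A * walsh_kernel (Suc m) k B)
      = (\<Sum>k<2 ^ m. ?w k) + (\<Sum>k<2 ^ m. ?w k * (-1) ^ (A mod 2 + B mod 2))"
    unfolding sum_lessThan_power_Suc
    by (intro arg_cong2[where f = "(+)"] sum.cong) (simp_all only: low high power_add lessThan_iff mult_ac)
  also have "\<dots> = (\<Sum>k<2 ^ m. ?w k) * (1 + (-1) ^ (A mod 2 + B mod 2))"
    by (simp add: sum_distrib_right distrib_left)
  also have "\<dots> = (if A = B then 2 ^ Suc m else 0)"
  proof -
    have "A = B \<longleftrightarrow> A div 2 = B div 2 \<and> A mod 2 = B mod 2"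
      by (metis div_mult_mod_eq)
    moreover have "A mod 2 = 0 \<or> A mod 2 = 1" "B mod 2 = 0 \<or> B mod 2 = 1" by auto
    ultimately show ?thesis unfolding IH by (auto simp: power2_eq_square)
  qed
  finally show ?case .
qed

section \<open>Decay of the Walsh coefficients of initial intervals in terms of
  \<open>mu\<close>\<close>

lemma mu_eqI:
  assumes "2 ^ l \<le> k" "k < 2 ^ Suc l"
  shows "mu k = Suc l"
proof -
  have "k \<noteq> 0" using assms(1) by (metis not_le zero_less_power zero_less_numeral)
  moreover have "(THE l. 2 ^ (l - 1) \<le> k \<and> k < 2 ^ l) = Suc l"
  proof (rule the_equality)
    show "2 ^ (Suc l - 1) \<le> k \<and> k < 2 ^ Suc l" using assms by simp
    fix n assume n: "2 ^ (n - 1) \<le> k \<and> k < 2 ^ n"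
    have "(2::nat) ^ l < 2 ^ n" "(2::nat) ^ (n - 1) < 2 ^ Suc l"
      using n assms by linarith+
    then have "l < n" "n - 1 < Suc l"
      by (simp_all only: power_strict_increasing_iff one_less_numeral_iff semiring_norm)
    then show "n = Suc l" by linarith
  qed
  ultimately show ?thesis by (simp add: mu_def)
qed

lemma mu_cases:
  obtains "k = 0" "mu k = 0" | l where "2 ^ l \<le> k" "k < 2 ^ Suc l" "mu k = Suc l"
proof (cases "k = 0")
  case True
  then show ?thesis using that by (simp add: mu_def)
next
  case False
  then obtain l where "2 ^ l \<le> k" "k < 2 ^ Suc l"
    using ex_power_ivl1[of 2 k] by auto
  then show ?thesis using that mu_eqI by blast
qed

lemma mu_le:
  assumes "k < 2 ^ m"
  shows "mu k \<le> m"
proof (cases k rule: mu_cases)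
  case (2 l)
  then have "(2::nat) ^ l < 2 ^ m" using assms by linarith
  then show ?thesis using 2 by simp
qed simp

lemma less_power_mu: "k < 2 ^ mu k"
  by (cases k rule: mu_cases) simp_all

text \<open>Halving the odd indices below \<open>c\<close> fills \<open>{..<c div 2}\<close>,
  halving the even ones fills \<open>{..<(c + 1) div 2}\<close>.\<close>

lemma sum_lessThan_div2:
  fixes g :: "nat \<Rightarrow> real"
  shows "(\<Sum>A<c. g (A div 2)) = (\<Sum>A<c div 2. g A) + (\<Sum>A<(c + 1) div 2. g A)"
proof (induction c)
  case (Suc c)
  show ?case
  proof (cases "even c")
    case True
    then obtain d where "c = 2 * d" by blast
    then show ?thesis using Suc by simp
  next
    case False
    then obtain d where "c = 2 * d + 1" by (blast elim: oddE)
    then show ?thesis using Suc by simp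
  qed
qed simp

text \<open>If the top bit of \<open>k\<close> is 0, the partial sum splits into two partial sums of
  the previous level, which doubles the bound. If it is 1, the sign \<open>(-1) ^ A\<close> makes
  neighbouring cells cancel in pairs and at most one term of modulus 1 is left.\<close>

lemma walsh_kernel_sum_bound:
  assumes "1 \<le> k" "k < 2 ^ m"
  shows "\<bar>\<Sum>A<c. walsh_kernel m k A\<bar> \<le> 2 ^ (m - mu k)"
  using assms
proof (induction m arbitrary: k c)
  case (Suc m)
  show ?case
  proof (cases "k < 2 ^ m")
    case True
    let ?S = "\<lambda>c. \<Sum>A<c. walsh_kernel m k A"
    have "(\<Sum>A<c. walsh_kernel (Suc m) k A) = (\<Sum>A<c. walsh_kernel m k (A div 2))"
      using walsh_kernel_Suc[OF True, of 0] by simp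
    also have "\<dots> = ?S (c div 2) + ?S ((c + 1) div 2)" by (rule sum_lessThan_div2)
    also have "\<bar>\<dots>\<bar> \<le> 2 ^ (m - mu k) + 2 ^ (m - mu k)"
      using Suc.IH[OF Suc.prems(1) True, of "c div 2"] Suc.IH[OF Suc.prems(1) True, of "(c + 1) div 2"]
      by linarith
    also have "\<dots> = 2 ^ (Suc m - mu k)"
      using mu_le[OF True] by (simp add: Suc_diff_le)
    finally show ?thesis .
  next
    case False
    then have mu: "mu k = Suc m" using Suc.prems mu_eqI by simp
    define r where "r = k - 2 ^ m"
    have r: "k = 2 ^ m * 1 + r" "r < 2 ^ m" using False Suc.prems by (auto simp: r_def)
    have w: "walsh_kernel (Suc m) k A = walsh_kernel m r (A div 2) * (-1) ^ A" for A
    proof -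
      have "(-1 :: real) ^ (A mod 2) = (-1) ^ A" by (cases "even A") auto
      then show ?thesis unfolding r(1) walsh_kernel_Suc[OF r(2) order_refl] by simp
    qed
    have "(\<Sum>A<c. walsh_kernel (Suc m) k A) = (if even c then 0 else walsh_kernel m r (c div 2))"
      by (induction c) (auto simp: w elim!: oddE evenE)
    then show ?thesis by (simp add: mu walsh_kernel_abs)
  qed
qed simp

text \<open>Summing the orthogonality relation over the cells \<open>B < c\<close> produces the
  indicator. Frequency 0 contributes \<open>real c\<close>, so the centring removes exactly the
  constant term.\<close>

lemma walsh_expansion:
  assumes "A < 2 ^ m" "c \<le> 2 ^ m"
  shows "of_bool (A < c) - real c / 2 ^ m
       = (\<Sum>k\<in>{1..2 ^ m - 1}. (1 / 2 ^ m * (\<Sum>B<c. walsh_kernel m k B)) * walsh_kernel m k A)"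
proof -
  have *: "{..<2 ^ m} = insert 0 {1..2 ^ m - 1 :: nat}"
  proof -
    have "(0::nat) < 2 ^ m" by simp
    then show ?thesis by (auto simp del: zero_less_power)
  qed
  have "(\<Sum>B<c. \<Sum>k<2 ^ m. walsh_kernel m k A * walsh_kernel m k B) = (\<Sum>B<c. if A = B then 2 ^ m else 0)"
    using assms by (intro sum.cong refl walsh_kernel_orthogonal) auto
  also have "\<dots> = 2 ^ m * of_bool (A < c)" by (simp add: sum.delta)
  finally have "2 ^ m * of_bool (A < c) = (\<Sum>k<2 ^ m. \<Sum>B<c. walsh_kernel m k A * walsh_kernel m k B)"
    by (subst sum.swap) simp
  also have "\<dots> = real c + (\<Sum>k\<in>{1..2 ^ m - 1}. \<Sum>B<c. walsh_kernel m k A * walsh_kernel m k B)"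
    unfolding * by (subst sum.insert) (auto simp: walsh_kernel_def)
  finally show ?thesis
    by (simp add: field_simps sum_distrib_left sum_divide_distrib)
qed

lemma walsh_coefficient_bound:
  assumes "k \<in> {1..2 ^ m - 1}"
  shows "\<bar>1 / 2 ^ m * (\<Sum>B<c. walsh_kernel m k B)\<bar> \<le> 1 / 2 ^ mu k"
proof -
  have k: "1 \<le> k" "k < 2 ^ m"
    using assms le_less_trans[of k "2 ^ m - 1" "2 ^ m"] by simp_all
  have "\<bar>1 / 2 ^ m * (\<Sum>B<c. walsh_kernel m k B)\<bar> \<le> 1 / 2 ^ m * 2 ^ (m - mu k)"
    using walsh_kernel_sum_bound[OF k, of c] by (simp add: abs_mult divide_right_mono)
  also have "\<dots> = 1 / 2 ^ mu k"
    using mu_le[OF k(2)] by (simp add: power_diff)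
  finally show ?thesis .
qed

section \<open>Dyadic digits and the centred discrepancy\<close>

lemma floor_double:
  fixes x :: real
  shows "\<lfloor>2 * x\<rfloor> = 2 * \<lfloor>x\<rfloor> \<or> \<lfloor>2 * x\<rfloor> = 2 * \<lfloor>x\<rfloor> + 1"
  by linarith

text \<open>The tail \<open>t\<close> beyond the first \<open>n\<close> digits is nonnegative and
  smaller than \<open>1 / 2 ^ n\<close>, so \<open>2 ^ n * x\<close> is an integer plus a remainder
  below 1. Strictness is where infinitely many digits different from 1 enter.\<close>

lemma binary_digit_floor:
  fixes \<xi> :: "nat \<Rightarrow> nat" and x :: real
  assumes dig: "\<And>j. \<xi> j \<in> {0, 1}" and inf: "infinite {j. \<xi> j \<noteq> 1}"
    and sums: "(\<lambda>j. real (\<xi> j) / 2 ^ (j + 1)) sums x"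
  shows "\<lfloor>2 ^ n * x\<rfloor> = (\<Sum>j<n. int (\<xi> j) * 2 ^ (n - 1 - j))"
proof -
  let ?g = "\<lambda>j. real (\<xi> j) / 2 ^ (j + 1)"
  define t where "t = (\<Sum>j. ?g (j + n))"
  have summ: "summable (\<lambda>j. ?g (j + n))"
    by (rule summable_ignore_initial_segment[OF sums_summable[OF sums]])
  have geo: "(\<lambda>j. 1 / 2 ^ (j + n + 1) :: real) sums (1 / 2 ^ n)"
  proof -
    have "(\<lambda>j. (1 / 2 ^ n) * (1 / 2) ^ Suc j :: real) sums ((1 / 2 ^ n) * 1)"
      by (intro sums_mult power_half_series)
    then show ?thesis by (simp add: power_add power_one_over mult_ac)
  qed
  have le: "?g (j + n) \<le> 1 / 2 ^ (j + n + 1)" for j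
    using dig[of "j + n"] by auto
  have "0 \<le> t" unfolding t_def by (rule suminf_nonneg[OF summ]) simp
  have "t < 1 / 2 ^ n"
  proof -
    obtain J where J: "n \<le> J" "\<xi> J \<noteq> 1"
      using inf unfolding infinite_nat_iff_unbounded_le by blast
    then have "\<xi> J = 0" using dig[of J] by auto
    \<comment> \<open>Termwise gap to the series of all ones; the digit 0 at place \<open>J\<close>
      makes its sum positive.\<close>
    let ?d = "\<lambda>j. 1 / 2 ^ (j + n + 1) - ?g (j + n)"
    have sd: "summable ?d"
      using summ geo by (intro summable_diff) (auto simp: sums_iff)
    have "0 < suminf ?d"
    proof (rule suminf_pos2[OF sd, of "J - n"])
      show "0 \<le> ?d j" for j using le[of j] by simp
      show "0 < ?d (J - n)" using J \<open>\<xi> J = 0\<close> by simp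
    qed
    also have "suminf ?d = 1 / 2 ^ n - t"
      unfolding t_def using suminf_diff[OF _ summ, of "\<lambda>j. 1 / 2 ^ (j + n + 1)"] geo
      by (simp add: sums_iff)
    finally show ?thesis by simp
  qed
  have "x = t + (\<Sum>j<n. ?g j)"
    unfolding t_def using suminf_split_initial_segment[of ?g n] sums by (simp add: sums_iff)
  then have "2 ^ n * x = 2 ^ n * t + (\<Sum>j<n. 2 ^ n * ?g j)"
    by (simp add: distrib_left sum_distrib_left)
  also have "(\<Sum>j<n. 2 ^ n * ?g j) = (\<Sum>j<n. real (\<xi> j) * 2 ^ (n - 1 - j))"
  proof (intro sum.cong refl)
    fix j assume "j \<in> {..<n}"
    then have "n - 1 - j + (j + 1) = n" by auto
    then have "(2::real) ^ n = 2 ^ (n - 1 - j) * 2 ^ (j + 1)"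
      by (simp only: power_add[symmetric])
    then show "2 ^ n * ?g j = real (\<xi> j) * 2 ^ (n - 1 - j)" by simp
  qed
  also have "\<dots> = of_int (\<Sum>j<n. int (\<xi> j) * 2 ^ (n - 1 - j))" by simp
  finally have "2 ^ n * x = 2 ^ n * t + of_int (\<Sum>j<n. int (\<xi> j) * 2 ^ (n - 1 - j))" .
  moreover have "0 \<le> 2 ^ n * t" "2 ^ n * t < 1"
    using \<open>0 \<le> t\<close> \<open>t < 1 / 2 ^ n\<close> by (simp_all add: field_simps)
  ultimately show ?thesis by linarith
qed

text \<open>The differences of successive floors satisfy the conditions in
  \<open>dyadic_digits\<close>, and every sequence satisfying them has the same floors, hence the
  same digits.\<close>

lemma dyadic_digits_eq:
  assumes "0 \<le> x" "x < 1"
  shows "dyadic_digits x j = nat (\<lfloor>2 ^ (j + 1) * x\<rfloor> - 2 * \<lfloor>2 ^ j * x\<rfloor>)"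
proof -
  define d where "d j = nat (\<lfloor>2 ^ (j + 1) * x\<rfloor> - 2 * \<lfloor>2 ^ j * x\<rfloor>)" for j
  have step: "\<lfloor>2 ^ (j + 1) * x\<rfloor> = 2 * \<lfloor>2 ^ j * x\<rfloor> + int (d j)" "d j \<in> {0, 1}" for j
    using floor_double[of "2 ^ j * x"] by (auto simp: d_def mult.assoc)
  have partial: "(\<Sum>j<n. real (d j) / 2 ^ (j + 1)) = \<lfloor>2 ^ n * x\<rfloor> / 2 ^ n" for n
  proof (induction n)
    case 0
    have "\<lfloor>x\<rfloor> = 0" using assms by linarith
    then show ?case by simp
  next
    case (Suc n)
    then show ?case using step(1)[of n] by (simp add: field_simps)
  qed
  have sums: "(\<lambda>j. real (d j) / 2 ^ (j + 1)) sums x"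
  proof -
    have "(\<lambda>n. x - (1 / 2) ^ n) \<longlonglongrightarrow> x - 0"
      by (intro tendsto_intros LIMSEQ_power_zero) simp
    then have lim: "(\<lambda>n. x - (1 / 2) ^ n) \<longlonglongrightarrow> x" by simp
    have "x - (1 / 2) ^ n \<le> \<lfloor>2 ^ n * x\<rfloor> / 2 ^ n" "\<lfloor>2 ^ n * x\<rfloor> / 2 ^ n \<le> x" for n
    proof -
      have "2 ^ n * x - 1 \<le> \<lfloor>2 ^ n * x\<rfloor>" "\<lfloor>2 ^ n * x\<rfloor> \<le> 2 ^ n * x" by linarith+
      then have "(2 ^ n * x - 1) / 2 ^ n \<le> \<lfloor>2 ^ n * x\<rfloor> / 2 ^ n"
          "\<lfloor>2 ^ n * x\<rfloor> / 2 ^ n \<le> 2 ^ n * x / 2 ^ n"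
        by (intro divide_right_mono; simp)+
      then show "x - (1 / 2) ^ n \<le> \<lfloor>2 ^ n * x\<rfloor> / 2 ^ n" "\<lfloor>2 ^ n * x\<rfloor> / 2 ^ n \<le> x"
        by (simp_all add: diff_divide_distrib power_one_over)
    qed
    then show ?thesis unfolding sums_def partial
      by (intro tendsto_sandwich[OF always_eventually always_eventually lim tendsto_const]) simp_all
  qed
  have inf: "infinite {j. d j \<noteq> 1}"
  proof
    assume "finite {j. d j \<noteq> 1}"
    then obtain n where "{j. d j \<noteq> 1} \<subseteq> {..<n}"
      using finite_nat_iff_bounded by blast
    then have n: "d j = 1" if "j \<ge> n" for j using that by force
    have fl: "\<lfloor>2 ^ (n + i) * x\<rfloor> + 1 = 2 ^ i * (\<lfloor>2 ^ n * x\<rfloor> + 1)" for i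
    proof (induction i)
      case (Suc i)
      then show ?case using step(1)[of "n + i"] n[of "n + i"] by (simp add: algebra_simps)
    qed simp
    \<comment> \<open>If all digits from \<open>n\<close> on were 1, the distance \<open>e\<close>
      to the next integer would double at every further digit and yet stay at most 1.\<close>
    define e where "e = \<lfloor>2 ^ n * x\<rfloor> + 1 - 2 ^ n * x"
    have "0 < e" unfolding e_def by linarith
    have "2 ^ i * e \<le> 1" for i
    proof -
      have "2 ^ i * e = of_int (2 ^ i * (\<lfloor>2 ^ n * x\<rfloor> + 1)) - 2 ^ (n + i) * x"
        by (simp add: e_def algebra_simps power_add)
      also have "\<dots> \<le> 1" unfolding fl[symmetric] by linarith
      finally show ?thesis .
    qed
    moreover obtain i where "1 / e < 2 ^ i"
      using real_arch_pow[of 2 "1 / e"] by auto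
    ultimately show False using \<open>0 < e\<close> by (metis divide_less_eq not_le)
  qed
  have "dyadic_digits x = d" unfolding dyadic_digits_def
  proof (rule the_equality)
    show "(\<forall>j. d j \<in> {0, 1}) \<and> infinite {j. d j \<noteq> 1} \<and> (\<lambda>j. real (d j) / 2 ^ (j + 1)) sums x"
      using step(2) inf sums by blast
    fix \<xi> :: "nat \<Rightarrow> nat"
    assume \<xi>: "(\<forall>j. \<xi> j \<in> {0, 1}) \<and> infinite {j. \<xi> j \<noteq> 1} \<and> (\<lambda>j. real (\<xi> j) / 2 ^ (j + 1)) sums x"
    have fl: "\<lfloor>2 ^ n * x\<rfloor> = (\<Sum>j<n. int (\<xi> j) * 2 ^ (n - 1 - j))" for n
      by (rule binary_digit_floor) (use \<xi> in auto)
    have "\<lfloor>2 ^ (j + 1) * x\<rfloor> = 2 * \<lfloor>2 ^ j * x\<rfloor> + int (\<xi> j)" for j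
    proof -
      have "(\<Sum>i<j. int (\<xi> i) * 2 ^ (j - i)) = (\<Sum>i<j. 2 * (int (\<xi> i) * 2 ^ (j - 1 - i)))"
      proof (intro sum.cong refl)
        fix i assume "i \<in> {..<j}"
        then have "j - i = Suc (j - 1 - i)" by auto
        then show "int (\<xi> i) * 2 ^ (j - i) = 2 * (int (\<xi> i) * 2 ^ (j - 1 - i))" by simp
      qed
      then show ?thesis unfolding fl by (simp add: sum_distrib_left)
    qed
    then show "\<xi> = d" using step(1) by (intro ext) (metis add_left_cancel of_nat_eq_iff)
  qed
  then show ?thesis by (simp add: d_def)
qed

text \<open>The integer part of \<open>2 ^ m * x\<close> stores the first \<open>m\<close> digits of
  \<open>x\<close>, and a frequency below \<open>2 ^ m\<close> involves no later ones.\<close>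

lemma wal_eq_walsh_kernel:
  assumes x: "0 \<le> x" "x < 1" and k: "k < 2 ^ m"
  shows "wal k x = walsh_kernel m k (nat \<lfloor>2 ^ m * x\<rfloor>)"
proof -
  have div: "nat \<lfloor>2 ^ m * x\<rfloor> div 2 ^ i = nat \<lfloor>2 ^ (m - i) * x\<rfloor>" if "i \<le> m" for i
  proof -
    have "(2::real) ^ m = 2 ^ (m - i) * 2 ^ i" using that by (simp flip: power_add)
    then have "2 ^ (m - i) * x = (2 ^ m * x) / of_int (2 ^ i)" by simp
    then have "\<lfloor>2 ^ (m - i) * x\<rfloor> = \<lfloor>2 ^ m * x\<rfloor> div 2 ^ i"
      by (metis floor_divide_real_eq_div zero_le_numeral zero_le_power)
    then show ?thesis using x by (simp add: nat_div_distrib nat_power_eq)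
  qed
  have digit: "nat \<lfloor>2 ^ m * x\<rfloor> div 2 ^ (m - 1 - j) mod 2 = dyadic_digits x j" if "j < m" for j
  proof -
    have "m - (m - 1 - j) = j + 1" using that by simp
    moreover have "nat \<lfloor>2 ^ (j + 1) * x\<rfloor> mod 2 = dyadic_digits x j"
      unfolding dyadic_digits_eq[OF x]
      using floor_double[of "2 ^ j * x"] x
      by (auto simp: mult.assoc nat_mult_distrib nat_add_distrib)
    ultimately show ?thesis using div[of "m - 1 - j"] by simp
  qed
  have "wal k x = (\<Prod>j<mu k. (-1) ^ ((k div 2 ^ j mod 2) * dyadic_digits x j))"
    by (simp add: wal_def power_sum)
  \<comment> \<open>The bits of \<open>k\<close> from place \<open>mu k\<close> on are 0, so the
    added factors are 1.\<close>
  also have "\<dots> = (\<Prod>j<m. (-1) ^ ((k div 2 ^ j mod 2) * dyadic_digits x j))"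
  proof (rule prod.mono_neutral_left)
    show "\<forall>j\<in>{..<m} - {..<mu k}. (-1::real) ^ ((k div 2 ^ j mod 2) * dyadic_digits x j) = 1"
    proof
      fix j assume "j \<in> {..<m} - {..<mu k}"
      then have "k < 2 ^ j"
        using less_le_trans[OF less_power_mu[of k] power_increasing[of "mu k" j "2::nat"]] by auto
      then show "(-1::real) ^ ((k div 2 ^ j mod 2) * dyadic_digits x j) = 1" by simp
    qed
  qed (use mu_le[OF k] in auto)
  also have "\<dots> = walsh_kernel m k (nat \<lfloor>2 ^ m * x\<rfloor>)"
    unfolding walsh_kernel_def by (intro prod.cong refl) (simp only: digit lessThan_iff)
  finally show ?thesis .
qed

lemma centred_indicator_walsh:
  assumes x: "0 \<le> x" "x < 1" and c: "c \<le> 2 ^ m"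
  shows "of_bool (x < real c / 2 ^ m) - real c / 2 ^ m
       = (\<Sum>k\<in>{1..2 ^ m - 1}. (1 / 2 ^ m * (\<Sum>B<c. walsh_kernel m k B)) * wal k x)"
proof -
  let ?A = "nat \<lfloor>2 ^ m * x\<rfloor>"
  have "2 ^ m * x < 2 ^ m" using x by simp
  then have A: "?A < 2 ^ m" using x by (simp add: nat_less_iff floor_less_iff)
  have lt: "x < real c / 2 ^ m \<longleftrightarrow> ?A < c"
    using x by (simp add: nat_less_iff floor_less_iff field_simps)
  show ?thesis unfolding lt walsh_expansion[OF A c]
  proof (intro sum.cong refl)
    fix k :: nat assume "k \<in> {1..2 ^ m - 1}"
    then have "k < 2 ^ m" using le_less_trans[of k "2 ^ m - 1" "2 ^ m"] by simp
    then show "1 / 2 ^ m * sum (walsh_kernel m k) {..<c} * walsh_kernel m k ?A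
        = 1 / 2 ^ m * sum (walsh_kernel m k) {..<c} * wal k x"
      using wal_eq_walsh_kernel[OF x] by simp
  qed
qed

text \<open>The kernel of the error functional on the component \<open>u\<close>: no mean over coordinates outside
  \<open>u\<close> occurs, so only frequencies with all \<open>k i > 0\<close> contribute.\<close>

definition centred_disc :: "nat \<Rightarrow> (nat \<Rightarrow> nat \<Rightarrow> real) \<Rightarrow> nat set \<Rightarrow> (nat \<Rightarrow> real) \<Rightarrow> real" where
  "centred_disc m y u t = 1 / 2 ^ m * (\<Sum>n<2 ^ m. \<Prod>i\<in>u. of_bool (y n i \<le> t i) - t i)"

text \<open>The product of the one-dimensional expansions is multiplied out and the mean over the
  points is taken inside. Each coefficient factor is at most \<open>1 / 2 ^ mu (k i)\<close>, and
  what remains is the mean of a multivariate Walsh function with all frequencies positive.\<close>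

lemma grid_discrepancy_bound:
  assumes fin: "finite u" and c: "\<And>i. i \<in> u \<Longrightarrow> c i \<le> 2 ^ m"
    and y: "\<And>n i. n < 2 ^ m \<Longrightarrow> i \<in> u \<Longrightarrow> 0 \<le> y n i \<and> y n i < 1"
  shows "\<bar>1 / 2 ^ m * (\<Sum>n<2 ^ m. \<Prod>i\<in>u. of_bool (y n i < real (c i) / 2 ^ m) - real (c i) / 2 ^ m)\<bar>
       \<le> walsh_sum m y u"
proof -
  define a where "a i k = 1 / 2 ^ m * (\<Sum>B<c i. walsh_kernel m k B)" for i k
  let ?K = "\<Pi>\<^sub>E i\<in>u. {1..2 ^ m - 1 :: nat}"
  let ?W = "\<lambda>k. 1 / 2 ^ m * (\<Sum>n<2 ^ m. \<Prod>i\<in>u. wal (k i) (y n i))"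
  have "(\<Sum>n<2 ^ m. \<Prod>i\<in>u. of_bool (y n i < real (c i) / 2 ^ m) - real (c i) / 2 ^ m)
      = (\<Sum>n<2 ^ m. \<Prod>i\<in>u. \<Sum>k\<in>{1..2 ^ m - 1}. a i k * wal k (y n i))"
    unfolding a_def by (intro sum.cong prod.cong refl centred_indicator_walsh) (use c y in auto)
  also have "\<dots> = (\<Sum>n<2 ^ m. \<Sum>k\<in>?K. (\<Prod>i\<in>u. a i (k i)) * (\<Prod>i\<in>u. wal (k i) (y n i)))"
    by (subst prod_sum_PiE) (simp_all add: fin prod.distrib)
  also have "\<dots> = (\<Sum>k\<in>?K. (\<Prod>i\<in>u. a i (k i)) * (\<Sum>n<2 ^ m. \<Prod>i\<in>u. wal (k i) (y n i)))"
    by (subst sum.swap) (simp add: sum_distrib_left)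
  finally have "\<bar>1 / 2 ^ m * (\<Sum>n<2 ^ m. \<Prod>i\<in>u. of_bool (y n i < real (c i) / 2 ^ m) - real (c i) / 2 ^ m)\<bar>
      = \<bar>\<Sum>k\<in>?K. (\<Prod>i\<in>u. a i (k i)) * ?W k\<bar>"
    by (simp add: sum_distrib_left mult_ac)
  also have "\<dots> \<le> (\<Sum>k\<in>?K. \<bar>(\<Prod>i\<in>u. a i (k i)) * ?W k\<bar>)"
    by (rule sum_abs)
  also have "\<dots> \<le> (\<Sum>k\<in>?K. 1 / 2 ^ (\<Sum>i\<in>u. mu (k i)) * \<bar>?W k\<bar>)"
  proof (rule sum_mono)
    fix k assume k: "k \<in> ?K"
    have "(\<Prod>i\<in>u. \<bar>a i (k i)\<bar>) \<le> (\<Prod>i\<in>u. 1 / 2 ^ mu (k i))"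
      unfolding a_def by (intro prod_mono conjI walsh_coefficient_bound) (use k in auto)
    also have "\<dots> = 1 / 2 ^ (\<Sum>i\<in>u. mu (k i))" by (simp add: prod_dividef power_sum)
    finally show "\<bar>(\<Prod>i\<in>u. a i (k i)) * ?W k\<bar> \<le> 1 / 2 ^ (\<Sum>i\<in>u. mu (k i)) * \<bar>?W k\<bar>"
      unfolding abs_mult[of "\<Prod>i\<in>u. a i (k i)"] abs_prod by (rule mult_right_mono) simp
  qed
  finally show ?thesis unfolding walsh_sum_def .
qed

section \<open>Rounding to the dyadic grid under projection regularity\<close>

lemma double_le_power2: "1 \<le> n \<Longrightarrow> 2 * n \<le> (2::nat) ^ n"
  by (induction n rule: dec_induct) auto

lemma centred_disc_bound:
  assumes reg: "projection_regular s m y" and u: "u \<subseteq> {1..s}" "u \<noteq> {}"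
    and t: "\<And>i. i \<in> u \<Longrightarrow> t i \<in> {0..1}"
  shows "\<bar>centred_disc m y u t\<bar> \<le> 2 ^ card u / 2 ^ m + walsh_sum m y u"
proof -
  have fin: "finite u" using u finite_subset by blast
  have y: "0 \<le> y n i" "y n i < 1" if "n < 2 ^ m" "i \<in> u" for n i
  proof -
    have "y n \<in> (\<Pi>\<^sub>E i\<in>{1..s}. {0..<1})" "i \<in> {1..s}"
      using reg that u unfolding projection_regular_def by blast+
    then have "y n i \<in> {0..<1}" by (rule PiE_mem)
    then show "0 \<le> y n i" "y n i < 1" by simp_all
  qed
  define c where "c i = nat \<lfloor>2 ^ m * t i\<rfloor>" for i
  have c_bounds: "real (c i) \<le> 2 ^ m * t i" "2 ^ m * t i < real (c i) + 1" if "i \<in> u" for i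
    using t[OF that] unfolding c_def by (auto simp: of_nat_nat)
  have c_le: "c i \<le> 2 ^ m" if "i \<in> u" for i
  proof -
    have "2 ^ m * t i \<le> 2 ^ m" using t[OF that] by simp
    then have "real (c i) \<le> 2 ^ m" using c_bounds(1)[OF that] by (rule order_trans[rotated])
    then have "real (c i) \<le> real (2 ^ m)" by (simp only: of_nat_power of_nat_numeral)
    then show ?thesis by (simp only: of_nat_le_iff)
  qed
  define A where "A n i = of_bool (y n i \<le> t i) - t i" for n i
  \<comment> \<open>The comparison is strict because \<open>c i\<close> full cells form a half-open
    interval; a point equal to the grid value thus counts among the exceptional points
    \<open>?C\<close> below.\<close>
  define B where "B n i = of_bool (y n i < real (c i) / 2 ^ m) - real (c i) / 2 ^ m" for n i
  \<comment> \<open>One unit for the at most one point between the grid value and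
    \<open>t i\<close>, and one unit for shifting the centre by at most \<open>1 / 2 ^ m\<close> at
    each of the \<open>2 ^ m\<close> points.\<close>
  have coord: "(\<Sum>n<2 ^ m. \<bar>A n i - B n i\<bar>) \<le> 2" if i: "i \<in> u" for i
  proof -
    have lo: "real (c i) / 2 ^ m \<le> t i" and hi: "t i < (real (c i) + 1) / 2 ^ m"
      using c_bounds[OF i] by (simp_all add: field_simps)
    let ?C = "{n \<in> {..<2 ^ m}. real (c i) / 2 ^ m \<le> y n i \<and> y n i \<le> t i}"
    have "card ?C \<le> 1"
    proof (cases "c i < 2 ^ m")
      case True
      then have "\<exists>!n. n < 2 ^ m \<and> y n i \<in> {real (c i) / 2 ^ m..<(real (c i) + 1) / 2 ^ m}"
        using reg u i unfolding projection_regular_def by blast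
      then obtain n0 where "\<And>n. n < 2 ^ m \<Longrightarrow> y n i \<in> {real (c i) / 2 ^ m..<(real (c i) + 1) / 2 ^ m} \<Longrightarrow> n = n0"
        by blast
      then have "?C \<subseteq> {n0}" using hi by auto
      then show ?thesis using card_mono[of "{n0}" ?C] by simp
    next
      \<comment> \<open>Here \<open>t i = 1\<close>, where no elementary interval starts; no point
        reaches 1 either.\<close>
      case False
      then have "c i = 2 ^ m" using c_le[OF i] by simp
      then have "?C = {}" using y(2)[OF _ i] by force
      then show ?thesis by (simp only: card.empty)
    qed
    have "\<bar>A n i - B n i\<bar> \<le> of_bool (n \<in> ?C) + 1 / 2 ^ m" if "n \<in> {..<2 ^ m}" for n
      using lo hi that by (auto simp: A_def B_def add_divide_distrib)
    then have "(\<Sum>n<2 ^ m. \<bar>A n i - B n i\<bar>) \<le> (\<Sum>n<2 ^ m. of_bool (n \<in> ?C) + 1 / 2 ^ m)"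
      by (rule sum_mono)
    also have "\<dots> = real (card ?C) + 1"
    proof -
      have "(\<Sum>n<2 ^ m. of_bool (n \<in> ?C)) = real (card ({..<2 ^ m} \<inter> ?C))"
        by (simp only: sum_of_bool_eq finite_lessThan Collect_mem_eq)
      also have "{..<2 ^ m} \<inter> ?C = ?C" by auto
      finally show ?thesis by (simp only: sum.distrib) simp
    qed
    finally show ?thesis using \<open>card ?C \<le> 1\<close> by linarith
  qed
  have bounds: "\<bar>A n i\<bar> \<le> 1" "\<bar>B n i\<bar> \<le> 1" if "i \<in> u" for n i
  proof -
    have "real (c i) \<le> real (2 ^ m)" using c_le[OF that] by (simp only: of_nat_le_iff)
    then have "real (c i) / 2 ^ m \<le> 1" by simp
    moreover have "0 \<le> real (c i) / 2 ^ m" by simp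
    ultimately show "\<bar>A n i\<bar> \<le> 1" "\<bar>B n i\<bar> \<le> 1" using t[OF that] by (auto simp: A_def B_def)
  qed
  have "\<bar>(\<Sum>n<2 ^ m. \<Prod>i\<in>u. A n i) - (\<Sum>n<2 ^ m. \<Prod>i\<in>u. B n i)\<bar>
      \<le> (\<Sum>n<2 ^ m. \<bar>(\<Prod>i\<in>u. A n i) - (\<Prod>i\<in>u. B n i)\<bar>)"
    unfolding sum_subtractf[symmetric] by (rule sum_abs)
  \<comment> \<open>All factors have absolute value at most 1, so exchanging them one at a time
    costs at most the sum of the single changes.\<close>
  also have "\<dots> \<le> (\<Sum>n<2 ^ m. \<Sum>i\<in>u. \<bar>A n i - B n i\<bar>)"
    using bounds norm_prod_diff[of u "A _" "B _"] by (intro sum_mono) simp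
  also have "\<dots> = (\<Sum>i\<in>u. \<Sum>n<2 ^ m. \<bar>A n i - B n i\<bar>)" by (rule sum.swap)
  also have "\<dots> \<le> (\<Sum>i\<in>u. 2)" by (intro sum_mono coord)
  also have "\<dots> = real (2 * card u)" by simp
  also have "\<dots> \<le> real (2 ^ card u)"
    using double_le_power2[of "card u"] u fin by (intro of_nat_mono) (simp add: Suc_leI card_gt_0_iff)
  finally have diff: "\<bar>(\<Sum>n<2 ^ m. \<Prod>i\<in>u. A n i) - (\<Sum>n<2 ^ m. \<Prod>i\<in>u. B n i)\<bar> \<le> 2 ^ card u"
    by simp
  have "\<bar>1 / 2 ^ m * (\<Sum>n<2 ^ m. \<Prod>i\<in>u. A n i) - 1 / 2 ^ m * (\<Sum>n<2 ^ m. \<Prod>i\<in>u. B n i)\<bar>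
      \<le> 2 ^ card u / 2 ^ m"
    unfolding right_diff_distrib[symmetric] abs_mult using diff by (simp add: field_simps)
  moreover have "\<bar>1 / 2 ^ m * (\<Sum>n<2 ^ m. \<Prod>i\<in>u. B n i)\<bar> \<le> walsh_sum m y u"
    unfolding B_def by (rule grid_discrepancy_bound) (use fin c_le y in auto)
  ultimately show ?thesis unfolding centred_disc_def A_def[symmetric] by linarith
qed

section \<open>Mixed differences and summation by parts\<close>

definition fwd_diff :: "(nat \<Rightarrow> real) \<Rightarrow> nat \<Rightarrow> ((nat \<Rightarrow> real) \<Rightarrow> real) \<Rightarrow> ((nat \<Rightarrow> real) \<Rightarrow> real)" where
  "fwd_diff h i F = (\<lambda>x. F (x(i := x i + h i)) - F x)"

lemma fwd_diff_apply: "fwd_diff h i F x = F (x(i := x i + h i)) - F x"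
  by (simp add: fwd_diff_def)

lemma foldr_fwd_diff_Cons:
  "foldr (fwd_diff h) (i # us) F x =
    foldr (fwd_diff h) us F (x(i := x i + h i)) - foldr (fwd_diff h) us F x"
  by (simp only: foldr_Cons o_apply fwd_diff_apply)

text \<open>Shifts in different coordinates commute, so the innermost difference can be taken
  outermost. This is what allows the last direction to be peeled off.\<close>

lemma foldr_fwd_diff_snoc:
  assumes "k \<notin> set us"
  shows "foldr (fwd_diff h) (us @ [k]) F x =
    foldr (fwd_diff h) us F (x(k := x k + h k)) - foldr (fwd_diff h) us F x"
  using assms
proof (induction us arbitrary: x)
  case (Cons i us)
  then have k: "i \<noteq> k" "k \<notin> set us" by auto
  have "(x(i := x i + h i))(k := (x(i := x i + h i)) k + h k) =
      (x(k := x k + h k))(i := (x(k := x k + h k)) i + h i)"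
    using k by (simp add: fun_upd_twist)
  then show ?case
    unfolding append_Cons foldr_fwd_diff_Cons Cons.IH[OF k(2)] by simp
qed (simp add: fwd_diff_apply)

lemma box_on_fun_upd:
  assumes "x \<in> box_on s a b" "i \<in> {1..s}" "t \<in> {a i..b i}"
  shows "x(i := t) \<in> box_on s a b"
  using assms unfolding box_on_def
  by (auto simp: PiE_iff extensional_def)

lemma box_onD:
  assumes "x \<in> box_on s a b" "i \<in> {1..s}"
  shows "x i \<in> {a i..b i}"
  using assms unfolding box_on_def by (rule PiE_mem)

text \<open>Iterated differences in directions other than \<open>k\<close> are signed sums of shifts
  that leave coordinate \<open>k\<close> alone, so they commute with the derivative in
  \<open>k\<close>. The conditions on \<open>h\<close> keep all shifted points in the box.\<close>

lemma foldr_fwd_diff_has_derivative: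
  assumes "distinct us" "set us \<subseteq> {1..s}" "k \<in> {1..s}" "k \<notin> set us"
    and "\<And>z. z \<in> box_on s a b \<Longrightarrow>
      ((\<lambda>r. F (z(k := r))) has_real_derivative F' z) (at (z k) within {a k..b k})"
    and "x \<in> box_on s a b" "\<And>i. i \<in> set us \<Longrightarrow> 0 \<le> h i" "\<And>i. i \<in> set us \<Longrightarrow> x i + h i \<le> b i"
  shows "((\<lambda>r. foldr (fwd_diff h) us F (x(k := r))) has_real_derivative foldr (fwd_diff h) us F' x)
    (at (x k) within {a k..b k})"
  using assms
proof (induction us arbitrary: x)
  case (Cons i us)
  let ?D = "foldr (fwd_diff h) us"
  let ?x = "x(i := x i + h i)"
  have "i \<noteq> k" using Cons.prems(4) by auto
  have "x i \<in> {a i..b i}" by (rule box_onD) (use Cons.prems in auto)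
  then have "?x \<in> box_on s a b"
    using Cons.prems(2,6,7,8) by (intro box_on_fun_upd) (auto intro: add_increasing2)
  then have "((\<lambda>r. ?D F (?x(k := r))) has_real_derivative ?D F' ?x) (at (?x k) within {a k..b k})"
    using Cons.prems(5)
  proof (intro Cons.IH)
    show "?x j + h j \<le> b j" if "j \<in> set us" for j
      using Cons.prems(1) Cons.prems(8)[of j] that by auto
  qed (use Cons.prems \<open>?x \<in> _\<close> in \<open>auto simp del: fun_upd_apply\<close>)
  moreover have "((\<lambda>r. ?D F (x(k := r))) has_real_derivative ?D F' x) (at (x k) within {a k..b k})"
    using Cons.prems by (intro Cons.IH) (auto simp del: fun_upd_apply)
  ultimately have "((\<lambda>r. ?D F (?x(k := r)) - ?D F (x(k := r))) has_real_derivative ?D F' ?x - ?D F' x)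
      (at (x k) within {a k..b k})"
    using \<open>i \<noteq> k\<close> by (auto intro: DERIV_diff)
  moreover have "(x(k := r))(i := (x(k := r)) i + h i) = ?x(k := r)" for r
    using \<open>i \<noteq> k\<close> by (simp add: fun_upd_twist)
  ultimately show ?case
    unfolding foldr_fwd_diff_Cons by simp
qed simp

lemma partial_deriv_has_derivative:
  assumes "(\<lambda>t. F (x(i := t))) differentiable (at (x i) within {a i..b i})"
  shows "((\<lambda>t. F (x(i := t))) has_real_derivative partial_deriv a b i F x) (at (x i) within {a i..b i})"
  using assms unfolding partial_deriv_def has_real_derivative_iff_has_vector_derivative
  by (simp add: vector_derivative_works)

text \<open>Peeling off the last (innermost) direction keeps the order of differentiation fixed, so that
  no symmetry of mixed partial derivatives is needed.\<close>

lemma foldr_fwd_diff_bound: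
  assumes "distinct us" "set us \<subseteq> {1..s}"
    and "\<And>vs i ws x. us = vs @ i # ws \<Longrightarrow> x \<in> box_on s a b \<Longrightarrow>
      (\<lambda>t. foldr (partial_deriv a b) ws F (x(i := t))) differentiable (at (x i) within {a i..b i})"
    and "\<And>z. z \<in> box_on s a b \<Longrightarrow> \<bar>foldr (partial_deriv a b) us F z\<bar> \<le> B"
    and "x \<in> box_on s a b" "\<And>i. i \<in> set us \<Longrightarrow> 0 \<le> h i" "\<And>i. i \<in> set us \<Longrightarrow> x i + h i \<le> b i"
  shows "\<bar>foldr (fwd_diff h) us F x\<bar> \<le> (\<Prod>i\<in>set us. h i) * B"
  using assms
proof (induction us arbitrary: F x rule: rev_induct)
  case (snoc k us)
  let ?D = "foldr (fwd_diff h) us" and ?G = "partial_deriv a b k F"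
  let ?g = "\<lambda>t. ?D F (x(k := t))"
  have k: "k \<in> {1..s}" "k \<notin> set us" using snoc.prems by auto
  have xk: "x k \<in> {a k..b k}" "x k + h k \<in> {a k..b k}"
    using box_onD[OF snoc.prems(5) k(1)] snoc.prems(6)[of k] snoc.prems(7)[of k] by auto
  have F': "((\<lambda>r. F (z(k := r))) has_real_derivative ?G z) (at (z k) within {a k..b k})"
    if "z \<in> box_on s a b" for z
  proof (rule partial_deriv_has_derivative)
    show "(\<lambda>t. F (z(k := t))) differentiable at (z k) within {a k..b k}"
      using snoc.prems(3)[of us k "[]" z] that by (simp del: fun_upd_apply)
  qed
  have G: "(\<lambda>t. foldr (partial_deriv a b) ws ?G (z(i := t))) differentiable (at (z i) within {a i..b i})"
    if "us = vs @ i # ws" "z \<in> box_on s a b" for vs i ws z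
    using snoc.prems(3)[of vs i "ws @ [k]" z] that by (simp del: fun_upd_apply)
  have box: "x(k := t) \<in> box_on s a b" if "t \<in> {a k..b k}" for t
    using that snoc.prems(5) k by (intro box_on_fun_upd)
  have shift: "(x(k := t)) i + h i \<le> b i" if "i \<in> set us" for t i
    using snoc.prems(7)[of i] that k by auto
  have "(?g has_real_derivative ?D ?G (x(k := t))) (at t within {a k..b k})" if "t \<in> {a k..b k}" for t
    using foldr_fwd_diff_has_derivative[of us s k a b F ?G "x(k := t)" h] F' box[OF that] shift snoc.prems k
    by simp
  moreover have "norm (?D ?G (x(k := t))) \<le> (\<Prod>i\<in>set us. h i) * B" if "t \<in> {a k..b k}" for t
    unfolding real_norm_def
  proof (rule snoc.IH)
    show "\<bar>foldr (partial_deriv a b) us ?G z\<bar> \<le> B" if "z \<in> box_on s a b" for z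
      using snoc.prems(4)[OF that] by simp
  qed (use G snoc.prems(1,2,6) box[OF that] shift in \<open>auto simp del: fun_upd_apply\<close>)
  \<comment> \<open>Mean value inequality in coordinate \<open>k\<close>; it requires only a bounded
    derivative at every point of the interval.\<close>
  ultimately have "norm (?g (x k + h k) - ?g (x k)) \<le> (\<Prod>i\<in>set us. h i) * B * norm (x k + h k - x k)"
    using xk by (intro field_differentiable_bound[of "{a k..b k}" ?g "\<lambda>t. ?D ?G (x(k := t))"])
      (simp_all del: fun_upd_apply)
  moreover have "foldr (fwd_diff h) (us @ [k]) F x = ?g (x k + h k) - ?g (x k)"
    using foldr_fwd_diff_snoc[OF k(2), of h F x] by simp
  moreover have "0 \<le> h k" using snoc.prems(6)[of k] by simp
  ultimately show ?case using k by (simp add: mult_ac)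
qed simp

text \<open>Translates from sets to lists: a suffix \<open>i # ws\<close> of the sorted list of
  \<open>u\<close> is the sorted list of a subset of \<open>u\<close> whose minimum is
  \<open>i\<close>.\<close>

lemma has_mixed_partialsD:
  assumes F: "has_mixed_partials s a b F" and u: "u \<subseteq> {1..s}"
    and us: "sorted_list_of_set u = vs @ i # ws" and x: "x \<in> box_on s a b"
  shows "(\<lambda>t. foldr (partial_deriv a b) ws F (x(i := t))) differentiable (at (x i) within {a i..b i})"
proof -
  have "sorted (i # ws)" "distinct (i # ws)"
    using sorted_sorted_list_of_set[of u] distinct_sorted_list_of_set[of u] unfolding us
    by (auto simp: sorted_append)
  then have list: "sorted_list_of_set (set ws) = ws"
    by (auto intro: sorted_list_of_set.idem_if_sorted_distinct)
  have "Min (set (i # ws)) = i"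
    using \<open>sorted (i # ws)\<close> by (intro Min_eqI) auto
  moreover have "set (i # ws) - {i} = set ws" using \<open>distinct (i # ws)\<close> by auto
  moreover have "set (i # ws) \<subseteq> {1..s}"
  proof -
    have "finite u" using u finite_subset by blast
    then have "u = set (vs @ i # ws)" by (metis us set_sorted_list_of_set)
    then show ?thesis using u by auto
  qed
  moreover have "set (i # ws) \<noteq> {}" by simp
  ultimately show ?thesis
    using F x list unfolding has_mixed_partials_def mixed_partial_def by metis
qed

lemma mixed_difference_bound:
  assumes F: "has_mixed_partials s a b F" and u: "u \<subseteq> {1..s}"
    and B: "\<And>z. z \<in> box_on s a b \<Longrightarrow> \<bar>mixed_partial a b u F z\<bar> \<le> B"
    and x: "x \<in> box_on s a b" and h: "\<And>i. i \<in> u \<Longrightarrow> 0 \<le> h i" "\<And>i. i \<in> u \<Longrightarrow> x i + h i \<le> b i"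
  shows "\<bar>foldr (fwd_diff h) (sorted_list_of_set u) F x\<bar> \<le> (\<Prod>i\<in>u. h i) * B"
proof -
  have "finite u" using u finite_subset by blast
  then have set: "set (sorted_list_of_set u) = u" by simp
  have "\<bar>foldr (fwd_diff h) (sorted_list_of_set u) F x\<bar> \<le> (\<Prod>i\<in>set (sorted_list_of_set u). h i) * B"
    using B[unfolded mixed_partial_def] x h u has_mixed_partialsD[OF F u]
    by (intro foldr_fwd_diff_bound[where s = s and a = a and b = b]) (simp_all del: fun_upd_apply add: set)
  then show ?thesis by (simp only: set)
qed

section \<open>Abel summation over multi-indices\<close>

lemma summation_by_parts:
  fixes g v :: "nat \<Rightarrow> real"
  shows "(\<Sum>t\<le>n. g t * v t) = g (Suc n) * (\<Sum>r\<le>n. v r) - (\<Sum>t\<le>n. (g (Suc t) - g t) * (\<Sum>r\<le>t. v r))"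
  by (induction n) (simp_all add: algebra_simps)

lemma sum_PiE_split:
  fixes f :: "('i \<Rightarrow> 'c) \<Rightarrow> real"
  assumes "i \<in> S"
  shows "(\<Sum>j\<in>PiE S (\<lambda>_. T). f j) = (\<Sum>j\<in>PiE (S - {i}) (\<lambda>_. T). \<Sum>t\<in>T. f (j(i := t)))"
proof -
  have "PiE S (\<lambda>_. T) = (\<lambda>(t, j). j(i := t)) ` (T \<times> PiE (S - {i}) (\<lambda>_. T))"
    using PiE_insert_eq[of i "S - {i}" "\<lambda>_. T"] assms by (simp add: insert_absorb)
  moreover have "inj_on (\<lambda>(t, j). j(i := t)) (T \<times> PiE (S - {i}) (\<lambda>_. T))"
    by (rule inj_combinator) simp
  ultimately have "(\<Sum>j\<in>PiE S (\<lambda>_. T). f j) = (\<Sum>(t, j)\<in>T \<times> PiE (S - {i}) (\<lambda>_. T). f (j(i := t)))"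
    by (simp add: sum.reindex case_prod_unfold)
  also have "\<dots> = (\<Sum>t\<in>T. \<Sum>j\<in>PiE (S - {i}) (\<lambda>_. T). f (j(i := t)))"
    by (simp add: sum.cartesian_product)
  also have "\<dots> = (\<Sum>j\<in>PiE (S - {i}) (\<lambda>_. T). \<Sum>t\<in>T. f (j(i := t)))"
    by (rule sum.swap)
  finally show ?thesis .
qed

text \<open>Abel summation in coordinate \<open>i\<close> with all others fixed; the boundary term
  vanishes because the total mass of \<open>v\<close> is 0.\<close>

lemma sum_PiE_by_parts:
  fixes G R :: "(nat \<Rightarrow> nat) \<Rightarrow> real" and v :: "nat \<Rightarrow> real"
  assumes i: "i \<in> S" and v: "(\<Sum>r\<le>n. v r) = 0" and R: "\<And>j t. R (j(i := t)) = R j"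
  shows "(\<Sum>j\<in>PiE S (\<lambda>_. {..n}). G j * (v (j i) * R j)) =
    - (\<Sum>j\<in>PiE S (\<lambda>_. {..n}). (G (j(i := Suc (j i))) - G j) * ((\<Sum>r\<le>j i. v r) * R j))"
proof -
  have "(\<Sum>t\<le>n. G (j(i := t)) * (v t * R j)) =
      - (\<Sum>t\<le>n. (G (j(i := Suc t)) - G (j(i := t))) * ((\<Sum>r\<le>t. v r) * R j))" for j
    using arg_cong[OF summation_by_parts[of "\<lambda>t. G (j(i := t))" v n], of "\<lambda>z. z * R j"]
    by (simp add: v sum_distrib_right mult.assoc)
  then show ?thesis
    unfolding sum_PiE_split[OF i] by (simp add: R sum_negf)
qed

definition grid_point :: "nat \<Rightarrow> (nat \<Rightarrow> real) \<Rightarrow> (nat \<Rightarrow> real) \<Rightarrow> (nat \<Rightarrow> nat) \<Rightarrow> nat \<Rightarrow> real" where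
  "grid_point s a h j = (\<lambda>i\<in>{1..s}. a i + real (j i) * h i)"

lemma grid_point_Suc:
  "i \<in> {1..s} \<Longrightarrow>
    grid_point s a h (j(i := Suc (j i))) = (grid_point s a h j)(i := grid_point s a h j i + h i)"
  by (auto simp: grid_point_def fun_eq_iff algebra_simps)

text \<open>One Abel summation per direction in \<open>us\<close>. The factor \<open>R\<close> is
  kept general in the induction so that it can absorb the factor of the direction whose turn is
  still to come.\<close>

lemma sum_grid_by_parts:
  fixes v :: "nat \<Rightarrow> nat \<Rightarrow> real"
  assumes "distinct us" "set us \<subseteq> {1..s}" "\<And>i. i \<in> set us \<Longrightarrow> (\<Sum>r\<le>n. v i r) = 0"
    and "\<And>i j t. i \<in> set us \<Longrightarrow> R (j(i := t)) = R j"
  shows "(\<Sum>j\<in>PiE {1..s} (\<lambda>_. {..n}). F (grid_point s a h j) * ((\<Prod>i\<in>set us. v i (j i)) * R j)) =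
    (-1) ^ length us * (\<Sum>j\<in>PiE {1..s} (\<lambda>_. {..n}). foldr (fwd_diff h) us F (grid_point s a h j) *
      ((\<Prod>i\<in>set us. \<Sum>r\<le>j i. v i r) * R j))"
  using assms
proof (induction us arbitrary: R)
  case (Cons i us)
  let ?J = "PiE {1..s} (\<lambda>_. {..n})" and ?G = "\<lambda>j. foldr (fwd_diff h) us F (grid_point s a h j)"
  let ?V = "\<lambda>i j. \<Sum>r\<le>j i. v i r"
  have i: "i \<in> {1..s}" "i \<notin> set us" using Cons.prems by auto
  have diff: "foldr (fwd_diff h) (i # us) F (grid_point s a h j) = ?G (j(i := Suc (j i))) - ?G j" for j
    using grid_point_Suc[OF i(1)] by (simp add: fwd_diff_def)
  have "(\<Sum>j\<in>?J. F (grid_point s a h j) * ((\<Prod>i\<in>set (i # us). v i (j i)) * R j))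
      = (\<Sum>j\<in>?J. F (grid_point s a h j) * ((\<Prod>i\<in>set us. v i (j i)) * (v i (j i) * R j)))"
    using i by (simp add: mult_ac)
  also have "\<dots> = (-1) ^ length us * (\<Sum>j\<in>?J. ?G j * ((\<Prod>i\<in>set us. ?V i j) * (v i (j i) * R j)))"
    using Cons.prems i by (intro Cons.IH) auto
  also have "(\<Sum>j\<in>?J. ?G j * ((\<Prod>i\<in>set us. ?V i j) * (v i (j i) * R j)))
      = (\<Sum>j\<in>?J. ?G j * (v i (j i) * ((\<Prod>i\<in>set us. ?V i j) * R j)))"
    by (simp add: mult_ac)
  also have "\<dots> = - (\<Sum>j\<in>?J. (?G (j(i := Suc (j i))) - ?G j) * (?V i j * ((\<Prod>i\<in>set us. ?V i j) * R j)))"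
  proof (rule sum_PiE_by_parts[OF i(1)])
    show "(\<Sum>r\<le>n. v i r) = 0" using Cons.prems(3) by simp
    fix j t
    have "(\<Prod>k\<in>set us. ?V k (j(i := t))) = (\<Prod>k\<in>set us. ?V k j)"
      using i by (intro prod.cong) auto
    then show "(\<Prod>k\<in>set us. ?V k (j(i := t))) * R (j(i := t)) = (\<Prod>k\<in>set us. ?V k j) * R j"
      using Cons.prems(4)[of i j t] by (simp del: fun_upd_apply)
  qed
  finally show ?case
    unfolding diff using i by (simp add: mult.assoc)
qed simp

section \<open>Discretising the quadrature error\<close>

text \<open>A countable cover by sets of finite measure for \<open>lborel\<close> also serves for
  its completion. This opens Fubini for products whose factors carry the Lebesgue
  sigma-algebra.\<close>

lemma sigma_finite_lebesgue: "sigma_finite_measure (lebesgue :: 'a::euclidean_space measure)"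
proof
  obtain C :: "'a set set" where C: "countable C" "C \<subseteq> sets lborel" "\<Union>C = space lborel"
      "\<forall>c\<in>C. emeasure lborel c \<noteq> \<infinity>"
    using lborel.sigma_finite_countable by blast
  then show "\<exists>C. countable C \<and> C \<subseteq> sets (lebesgue :: 'a measure) \<and> \<Union>C = space lebesgue \<and>
      (\<forall>c\<in>C. emeasure (lebesgue :: 'a measure) c \<noteq> \<infinity>)"
    by (intro exI[of _ C]) auto
qed

section \<open>Distribution functions, grid cells and their weights\<close>

locale density_box =
  fixes s :: nat and a b :: "nat \<Rightarrow> real" and \<phi> :: "nat \<Rightarrow> real \<Rightarrow> real"
  assumes less: "\<And>i. i \<in> {1..s} \<Longrightarrow> a i < b i"
    and dens: "\<And>i. i \<in> {1..s} \<Longrightarrow> prob_density_on (a i) (b i) (\<phi> i)"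
    and bij: "\<And>i. i \<in> {1..s} \<Longrightarrow> bij_betw (cdf_on (a i) (\<phi> i)) {a i..b i} {0..1}"
begin

abbreviation cdf :: "nat \<Rightarrow> real \<Rightarrow> real" where
  "cdf i \<equiv> cdf_on (a i) (\<phi> i)"

definition dens0 :: "nat \<Rightarrow> real \<Rightarrow> real" where
  "dens0 i x = indicator {a i..b i} x * \<phi> i x"

definition step :: "nat \<Rightarrow> nat \<Rightarrow> real" where
  "step M i = (b i - a i) / real M"

text \<open>The index of the first node at or to the right of \<open>x\<close>. Cells are closed on
  the right, to match the closed indicator \<open>y n i \<le> t i\<close>; the truncation by
  \<open>nat\<close> sends everything up to \<open>a i\<close> to cell 0.\<close>

definition cell :: "nat \<Rightarrow> nat \<Rightarrow> real \<Rightarrow> nat" where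
  "cell M i x = nat \<lceil>(x - a i) / step M i\<rceil>"

definition weight :: "nat \<Rightarrow> nat \<Rightarrow> nat \<Rightarrow> real" where
  "weight M i r = (\<integral>x. dens0 i x * indicator {x. cell M i x = r} x \<partial>lebesgue)"

definition round_up :: "nat \<Rightarrow> (nat \<Rightarrow> real) \<Rightarrow> (nat \<Rightarrow> real)" where
  "round_up M x = grid_point s a (step M) (\<lambda>i\<in>{1..s}. cell M i (x i))"

text \<open>The integral of the step function obtained by evaluating \<open>F\<close> at
  \<open>round_up M x\<close>, taken against the product density.\<close>

definition riemann_sum :: "nat \<Rightarrow> ((nat \<Rightarrow> real) \<Rightarrow> real) \<Rightarrow> real" where
  "riemann_sum M F =
    (\<Sum>j\<in>PiE {1..s} (\<lambda>_. {..M}). F (grid_point s a (step M) j) * (\<Prod>i\<in>{1..s}. weight M i (j i)))"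

lemma dens0_nonneg: "i \<in> {1..s} \<Longrightarrow> 0 \<le> dens0 i x"
  using dens[of i] by (auto simp: dens0_def prob_density_on_def indicator_def)

lemma dens0_integrable: "i \<in> {1..s} \<Longrightarrow> integrable lebesgue (dens0 i)"
  using dens[of i] by (simp add: dens0_def[abs_def] prob_density_on_def set_integrable_def)

lemma cdf_eq:
  assumes "i \<in> {1..s}" "x \<in> {a i..b i}"
  shows "cdf i x = (\<integral>t. dens0 i t * indicator {..x} t \<partial>lebesgue)"
  unfolding cdf_on_def set_lebesgue_integral_def dens0_def
  using assms by (intro Bochner_Integration.integral_cong refl) (auto simp: indicator_def)

lemma cdf_in: "i \<in> {1..s} \<Longrightarrow> x \<in> {a i..b i} \<Longrightarrow> cdf i x \<in> {0..1}"
  using bij[of i] by (auto simp: bij_betw_def)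

lemma cdf_mono:
  assumes i: "i \<in> {1..s}" and x: "x \<in> {a i..b i}" "z \<in> {a i..b i}" "x \<le> z"
  shows "cdf i x \<le> cdf i z"
  unfolding cdf_eq[OF i x(1)] cdf_eq[OF i x(2)]
  using dens0_nonneg[OF i] x(3)
  by (intro integral_mono integrable_real_mult_indicator dens0_integrable[OF i])
    (auto simp: indicator_def)

text \<open>Monotonicity comes from the nonnegative density, strictness from injectivity.\<close>

lemma cdf_le_iff:
  assumes i: "i \<in> {1..s}" and x: "x \<in> {a i..b i}" "z \<in> {a i..b i}"
  shows "cdf i x \<le> cdf i z \<longleftrightarrow> x \<le> z"
proof
  assume le: "cdf i x \<le> cdf i z"
  show "x \<le> z"
  proof (rule ccontr)
    assume "\<not> x \<le> z"
    then have "cdf i z = cdf i x" using cdf_mono[OF i x(2) x(1)] le by simp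
    then show False
      using bij[OF i] x \<open>\<not> x \<le> z\<close> unfolding bij_betw_def inj_on_def by (metis order_refl)
  qed
qed (rule cdf_mono[OF i x])

lemma cdf_right: "i \<in> {1..s} \<Longrightarrow> cdf i (b i) = 1"
  using less[of i] dens[of i] by (simp add: prob_density_on_def cdf_on_def)

lemma step_pos: "i \<in> {1..s} \<Longrightarrow> 0 < M \<Longrightarrow> 0 < step M i"
  using less[of i] by (simp add: step_def)

lemma cell_le_iff:
  assumes "i \<in> {1..s}" "0 < M"
  shows "cell M i x \<le> l \<longleftrightarrow> x \<le> a i + real l * step M i"
proof -
  have "cell M i x \<le> l \<longleftrightarrow> (x - a i) / step M i \<le> real l"
    unfolding cell_def by (simp add: nat_le_iff ceiling_le_iff)
  also have "\<dots> \<longleftrightarrow> x \<le> a i + real l * step M i"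
    using step_pos[OF assms] by (simp add: field_simps)
  finally show ?thesis .
qed

lemma node_in:
  assumes "i \<in> {1..s}" "0 < M" "l \<le> M"
  shows "a i + real l * step M i \<in> {a i..b i}"
proof -
  have "real l * step M i \<le> real M * step M i"
    using assms step_pos[of i M] by (intro mult_right_mono) auto
  moreover have "real M * step M i = b i - a i" using assms by (simp add: step_def)
  moreover have "0 \<le> real l * step M i" using assms step_pos[of i M] by simp
  ultimately show ?thesis by simp
qed

lemma node_last: "0 < M \<Longrightarrow> a i + real M * step M i = b i"
  by (simp add: step_def)

lemma cell_le:
  assumes "i \<in> {1..s}" "0 < M" "x \<in> {a i..b i}"
  shows "cell M i x \<le> M"
  using assms by (simp add: cell_le_iff node_last)

lemma cell_bounds:
  assumes "i \<in> {1..s}" "0 < M" "x \<in> {a i..b i}"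
  shows "x \<le> a i + real (cell M i x) * step M i" "a i + real (cell M i x) * step M i \<le> x + step M i"
proof -
  show "x \<le> a i + real (cell M i x) * step M i"
    using cell_le_iff[OF assms(1,2), of x "cell M i x"] by simp
  show "a i + real (cell M i x) * step M i \<le> x + step M i"
  proof (cases "cell M i x")
    case 0
    then show ?thesis using assms step_pos[OF assms(1,2)] by simp
  next
    case (Suc l)
    then have "a i + real l * step M i < x"
      using cell_le_iff[OF assms(1,2), of x l] by simp
    then show ?thesis using Suc by (simp add: algebra_simps)
  qed
qed

lemma cell_measurable:
  assumes "i \<in> {1..s}"
  shows "{x. cell M i x = r} \<in> sets lebesgue"
proof -
  have "{x \<in> space borel. cell M i x = r} \<in> sets borel"
    unfolding cell_def by measurable
  then show ?thesis by (simp add: sets_completionI_sets)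
qed

lemma weight_integrable:
  "i \<in> {1..s} \<Longrightarrow> integrable lebesgue (\<lambda>x. dens0 i x * indicator {x. cell M i x = r} x)"
  by (intro integrable_real_mult_indicator dens0_integrable cell_measurable)

lemma weight_nonneg: "i \<in> {1..s} \<Longrightarrow> 0 \<le> weight M i r"
  unfolding weight_def by (intro integral_nonneg_AE AE_I2) (simp add: dens0_nonneg)

text \<open>The cells \<open>0, ..., l\<close> together fill exactly the half-line up to node
  \<open>l\<close>.\<close>

lemma weight_cumulative:
  assumes i: "i \<in> {1..s}" and M: "0 < M" "l \<le> M"
  shows "(\<Sum>r\<le>l. weight M i r) = cdf i (a i + real l * step M i)"
proof -
  have "(\<Sum>r\<le>l. weight M i r) = (\<integral>x. (\<Sum>r\<le>l. dens0 i x * indicator {x. cell M i x = r} x) \<partial>lebesgue)"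
    unfolding weight_def by (rule Bochner_Integration.integral_sum[symmetric]) (rule weight_integrable[OF i])
  also have "(\<lambda>x. \<Sum>r\<le>l. dens0 i x * indicator {x. cell M i x = r} x)
      = (\<lambda>x. dens0 i x * indicator {..a i + real l * step M i} x)"
  proof
    fix x
    have "(\<Sum>r\<le>l. indicator {x. cell M i x = r} x) = (of_bool (cell M i x \<le> l) :: real)"
      by (simp add: indicator_def sum.delta)
    also have "\<dots> = indicator {..a i + real l * step M i} x"
      by (simp add: cell_le_iff[OF i M(1)] indicator_def)
    finally show "(\<Sum>r\<le>l. dens0 i x * indicator {x. cell M i x = r} x)
      = dens0 i x * indicator {..a i + real l * step M i} x"
      by (simp flip: sum_distrib_left)
  qed
  finally show ?thesis by (simp add: cdf_eq[OF i node_in[OF i M]])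
qed

lemma weight_total: "i \<in> {1..s} \<Longrightarrow> 0 < M \<Longrightarrow> (\<Sum>r\<le>M. weight M i r) = 1"
  using weight_cumulative[of i M M] by (simp add: node_last cdf_right)

lemma inv_cdf_in_box:
  assumes "\<And>i. i \<in> {1..s} \<Longrightarrow> y i \<in> {0..1}"
  shows "inv_cdf s a b \<phi> y \<in> box_on s a b"
proof -
  have "inv_into {a i..b i} (cdf i) (y i) \<in> {a i..b i}" if "i \<in> {1..s}" for i
    using bij[OF that] assms[OF that] by (intro inv_into_into) (simp add: bij_betw_def)
  then show ?thesis by (auto simp: inv_cdf_def box_on_def)
qed

lemma cdf_inv_cdf:
  assumes "i \<in> {1..s}" "y i \<in> {0..1}"
  shows "cdf i (inv_cdf s a b \<phi> y i) = y i"
  using bij[OF assms(1)] assms by (simp add: inv_cdf_def f_inv_into_f bij_betw_def)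

lemma grid_point_in_box:
  assumes "0 < M" "\<And>i. i \<in> {1..s} \<Longrightarrow> j i \<le> M"
  shows "grid_point s a (step M) j \<in> box_on s a b"
  using node_in[OF _ assms(1) assms(2)] by (auto simp: grid_point_def box_on_def)

text \<open>Evaluation points and integration nodes are both rounded up to the grid, so the cumulated
  weights are exact values of the centred kernel and no error of order \<open>1 / M\<close> arises here.\<close>

lemma cumulative_centred:
  assumes i: "i \<in> {1..s}" and M: "0 < M" "l \<le> M" and y: "y i \<in> {0..1}"
  shows "(\<Sum>r\<le>l. of_bool (r = cell M i (inv_cdf s a b \<phi> y i)) - weight M i r)
    = of_bool (y i \<le> cdf i (a i + real l * step M i)) - cdf i (a i + real l * step M i)"
proof -
  let ?x = "inv_cdf s a b \<phi> y i"
  have x: "?x \<in> {a i..b i}"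
    using inv_into_into[of "y i" "cdf i" "{a i..b i}"] bij[OF i] y i
    by (simp add: inv_cdf_def bij_betw_def)
  have "(\<Sum>r\<le>l. of_bool (r = cell M i ?x)) = (of_bool (cell M i ?x \<le> l) :: real)"
    by (simp add: of_bool_def sum.delta)
  also have "cell M i ?x \<le> l \<longleftrightarrow> ?x \<le> a i + real l * step M i"
    by (rule cell_le_iff[OF i M(1)])
  also have "\<dots> \<longleftrightarrow> cdf i ?x \<le> cdf i (a i + real l * step M i)"
    by (rule cdf_le_iff[OF i x node_in[OF i M], symmetric])
  also have "cdf i ?x = y i" by (rule cdf_inv_cdf[of i y, OF i y])
  finally show ?thesis by (simp add: sum_subtractf weight_cumulative[OF i M])
qed

text \<open>Gives evaluation the shape of \<open>riemann_sum\<close>, with Kronecker deltas in place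
  of the weights, so that the two can be compared factor by factor.\<close>

lemma eval_round_up:
  fixes F :: "(nat \<Rightarrow> real) \<Rightarrow> real"
  assumes M: "0 < M" and x: "x \<in> box_on s a b"
  shows "F (round_up M x) = (\<Sum>j\<in>PiE {1..s} (\<lambda>_. {..M}).
    F (grid_point s a (step M) j) * (\<Prod>i\<in>{1..s}. of_bool (j i = cell M i (x i))))"
proof -
  let ?c = "\<lambda>i\<in>{1..s}. cell M i (x i)"
  have c: "?c \<in> PiE {1..s} (\<lambda>_. {..M})"
    using cell_le[OF _ M box_onD[OF x]] by auto
  have delta: "(\<Prod>i\<in>{1..s}. of_bool (j i = cell M i (x i))) = (of_bool (j = ?c) :: real)"
    if j: "j \<in> PiE {1..s} (\<lambda>_. {..M})" for j
  proof (cases "j = ?c")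
    case False
    then obtain i where "i \<in> {1..s}" "j i \<noteq> cell M i (x i)"
      using PiE_ext[OF j c] by auto
    then show ?thesis using False by (auto intro!: prod_zero)
  qed simp
  have "(\<Sum>j\<in>PiE {1..s} (\<lambda>_. {..M}).
      F (grid_point s a (step M) j) * (\<Prod>i\<in>{1..s}. of_bool (j i = cell M i (x i))))
    = (\<Sum>j\<in>PiE {1..s} (\<lambda>_. {..M}). if j = ?c then F (grid_point s a (step M) j) else 0)"
  proof (rule sum.cong[OF refl])
    fix j assume "j \<in> PiE {1..s} (\<lambda>_. {..M})"
    then show "F (grid_point s a (step M) j) * (\<Prod>i\<in>{1..s}. of_bool (j i = cell M i (x i)))
      = (if j = ?c then F (grid_point s a (step M) j) else 0)" by (subst delta) auto
  qed
  also have "\<dots> = F (round_up M x)"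
    using c by (simp add: sum.delta finite_PiE round_up_def)
  finally show ?thesis by simp
qed

section \<open>The error bound at a fixed mesh width\<close>

lemma discrete_error_bound:
  assumes F: "has_mixed_partials s a b F" and reg: "projection_regular s m y" and M: "0 < M"
    and B: "\<And>u z. u \<subseteq> {1..s} \<Longrightarrow> z \<in> box_on s a b \<Longrightarrow> \<bar>mixed_partial a b u F z\<bar> \<le> B u"
  shows "\<bar>1 / 2 ^ m * (\<Sum>n<2 ^ m. F (round_up M (inv_cdf s a b \<phi> (y n)))) - riemann_sum M F\<bar>
    \<le> (\<Sum>u\<in>Pow {1..s} - {{}}. B u * ((\<Prod>i\<in>u. b i - a i) * (2 ^ card u / 2 ^ m + walsh_sum m y u)))"
proof -
  let ?J = "PiE {1..s} (\<lambda>_. {..M})" and ?U = "Pow {1..s} - {{}}"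
  let ?p = "grid_point s a (step M)"
  \<comment> \<open>Point mass minus integration weight in one coordinate: the discrete form of
    evaluation minus integration, of total mass 0.\<close>
  define v where "v n i r = of_bool (r = cell M i (inv_cdf s a b \<phi> (y n) i)) - weight M i r" for n i r
  define W where "W u j = (\<Prod>i\<in>{1..s} - u. weight M i (j i))" for u j
  define D where "D u j = foldr (fwd_diff (step M)) (sorted_list_of_set u) F (?p j)" for u j
  define c where "c u j = centred_disc m y u (\<lambda>i. cdf i (a i + real (j i) * step M i))" for u and j :: "nat \<Rightarrow> nat"
  define K where "K u = 2 ^ card u / 2 ^ m + walsh_sum m y u" for u
  have y: "y n i \<in> {0..1}" if "n < 2 ^ m" "i \<in> {1..s}" for n i
  proof -
    have "y n \<in> (\<Pi>\<^sub>E i\<in>{1..s}. {0..<1})"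
      using reg that unfolding projection_regular_def by blast
    from PiE_mem[OF this that(2)] show "y n i \<in> {0..1}" by simp
  qed
  have fin: "finite u" if "u \<in> ?U" for u
    using that finite_subset[of u "{1..s}"] by auto
  have V: "(\<Sum>r\<le>l. v n i r) = of_bool (y n i \<le> cdf i (a i + real l * step M i)) - cdf i (a i + real l * step M i)"
    if "n < 2 ^ m" "i \<in> {1..s}" "l \<le> M" for n i l
    unfolding v_def using that y M by (intro cumulative_centred) auto
  have V_last: "(\<Sum>r\<le>M. v n i r) = 0" if "n < 2 ^ m" "i \<in> {1..s}" for n i
    using V[OF that order_refl] y[OF that] that M by (simp add: node_last cdf_right)
  have parts: "(\<Sum>j\<in>?J. F (?p j) * ((\<Prod>i\<in>u. v n i (j i)) * W u j)) =
      (-1) ^ card u * (\<Sum>j\<in>?J. D u j * ((\<Prod>i\<in>u. \<Sum>r\<le>j i. v n i r) * W u j))"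
    if n: "n < 2 ^ m" and u: "u \<in> ?U" for n u
  proof -
    have set: "set (sorted_list_of_set u) = u" using fin[OF u] by simp
    have W: "W u (j(i := t)) = W u j" if "i \<in> u" for i j t
      unfolding W_def using that by (intro prod.cong) auto
    have u': "u \<subseteq> {1..s}" using u by simp
    show ?thesis
      using sum_grid_by_parts[where us = "sorted_list_of_set u" and s = s and n = M and v = "v n"
        and R = "W u" and F = F and a = a and h = "step M", unfolded set, OF _ u' V_last[OF n subsetD[OF u']] W]
      unfolding D_def by simp
  qed
  have expand: "F (round_up M (inv_cdf s a b \<phi> (y n))) - riemann_sum M F
      = (\<Sum>u\<in>?U. \<Sum>j\<in>?J. F (?p j) * ((\<Prod>i\<in>u. v n i (j i)) * W u j))"
    if n: "n < 2 ^ m" for n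
  proof -
    have "F (round_up M (inv_cdf s a b \<phi> (y n)))
        = (\<Sum>j\<in>?J. F (?p j) * (\<Prod>i\<in>{1..s}. v n i (j i) + weight M i (j i)))"
      using eval_round_up[OF M inv_cdf_in_box, of "y n" F] y n by (simp add: v_def)
    also have "\<dots> = (\<Sum>j\<in>?J. \<Sum>u\<in>Pow {1..s}. F (?p j) * ((\<Prod>i\<in>u. v n i (j i)) * W u j))"
      by (simp add: prod_add sum_distrib_left W_def)
    also have "\<dots> = (\<Sum>u\<in>Pow {1..s}. \<Sum>j\<in>?J. F (?p j) * ((\<Prod>i\<in>u. v n i (j i)) * W u j))"
      by (rule sum.swap)
    \<comment> \<open>The empty set contributes integration in every coordinate, that is, the
      Riemann sum.\<close>
    also have "\<dots> = riemann_sum M F + (\<Sum>u\<in>?U. \<Sum>j\<in>?J. F (?p j) * ((\<Prod>i\<in>u. v n i (j i)) * W u j))"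
      by (subst sum.remove[of _ "{}"]) (auto simp: W_def riemann_sum_def)
    finally show ?thesis by simp
  qed
  \<comment> \<open>Only the cumulated factors depend on the point \<open>n\<close>, and their mean
    is the centred discrepancy at the values of the distribution functions at the nodes.\<close>
  have average: "1 / 2 ^ m * (\<Sum>n<2 ^ m. \<Sum>j\<in>?J. D u j * ((\<Prod>i\<in>u. \<Sum>r\<le>j i. v n i r) * W u j))
      = (\<Sum>j\<in>?J. D u j * (c u j * W u j))" if u: "u \<in> ?U" for u
  proof -
    have "1 / 2 ^ m * (\<Sum>n<2 ^ m. \<Sum>j\<in>?J. D u j * ((\<Prod>i\<in>u. \<Sum>r\<le>j i. v n i r) * W u j))
        = (\<Sum>j\<in>?J. D u j * ((1 / 2 ^ m * (\<Sum>n<2 ^ m. \<Prod>i\<in>u. \<Sum>r\<le>j i. v n i r)) * W u j))"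
      by (subst sum.swap) (simp add: sum_distrib_left sum_distrib_right mult_ac)
    also have "\<dots> = (\<Sum>j\<in>?J. D u j * (c u j * W u j))"
    proof (intro sum.cong refl arg_cong2[where f = "(*)"])
      fix j assume j: "j \<in> ?J"
      show "1 / 2 ^ m * (\<Sum>n<2 ^ m. \<Prod>i\<in>u. \<Sum>r\<le>j i. v n i r) = c u j"
        unfolding c_def centred_disc_def
        by (intro arg_cong2[where f = "(*)"] sum.cong prod.cong refl V) (use u j in \<open>auto simp: PiE_iff\<close>)
    qed
    finally show ?thesis .
  qed
  have bound: "\<bar>\<Sum>j\<in>?J. D u j * (c u j * W u j)\<bar> \<le> B u * ((\<Prod>i\<in>u. b i - a i) * K u)"
    if u: "u \<in> ?U" for u
  proof -
    \<comment> \<open>A majorant that factorises over the coordinates: summed over \<open>t\<close>,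
      it gives the length \<open>b i - a i\<close> for \<open>i\<close> in \<open>u\<close> and the
      total weight 1 otherwise. The value 0 at \<open>t = M\<close> leaves exactly \<open>M\<close>
      steps.\<close>
    let ?e = "\<lambda>i t. if i \<in> u then (if t < M then step M i else 0) else weight M i t"
    have u': "u \<subseteq> {1..s}" "u \<noteq> {}" using u by auto
    have "0 \<le> \<bar>mixed_partial a b u F (?p (\<lambda>_. 0))\<bar>" by simp
    also have "\<dots> \<le> B u" using u' M by (intro B grid_point_in_box) auto
    finally have "0 \<le> B u" .
    have split: "(\<Prod>i\<in>{1..s}. ?e i (j i)) = (\<Prod>i\<in>u. if j i < M then step M i else 0) * W u j" for j
    proof -
      have "(\<Prod>i\<in>{1..s}. ?e i (j i)) = (\<Prod>i\<in>{1..s} - u. ?e i (j i)) * (\<Prod>i\<in>u. ?e i (j i))"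
        by (rule prod.subset_diff[OF u'(1)]) simp
      also have "(\<Prod>i\<in>{1..s} - u. ?e i (j i)) = W u j" unfolding W_def by (intro prod.cong) auto
      finally show ?thesis by (simp add: mult.commute)
    qed
    have W: "0 \<le> W u j" for j unfolding W_def by (intro prod_nonneg) (auto simp: weight_nonneg)
    have cK: "\<bar>c u j\<bar> \<le> K u" if "j \<in> ?J" for j
      unfolding c_def K_def using that u' M
      by (intro centred_disc_bound[OF reg u'] cdf_in node_in) (auto simp: PiE_iff)
    have "0 \<le> K u" using cK[of "\<lambda>i\<in>{1..s}. 0"] by (rule order_trans[OF abs_ge_zero]) auto
    have term_le: "\<bar>D u j * (c u j * W u j)\<bar> \<le> B u * K u * (\<Prod>i\<in>{1..s}. ?e i (j i))" if j: "j \<in> ?J" for j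
    proof (cases "\<forall>i\<in>u. j i < M")
      case True
      have "\<bar>D u j\<bar> \<le> (\<Prod>i\<in>u. step M i) * B u"
        unfolding D_def
      proof (rule mixed_difference_bound[OF F u'(1) B[OF u'(1)]])
        show "?p j \<in> box_on s a b" using j M by (intro grid_point_in_box) (auto simp: PiE_iff)
        show "0 \<le> step M i" if "i \<in> u" for i using step_pos[of i M] that u' M by auto
        show "?p j i + step M i \<le> b i" if "i \<in> u" for i
        proof -
          have "a i + real (Suc (j i)) * step M i \<in> {a i..b i}"
            using True that u' M by (intro node_in) auto
          then show ?thesis using that u' by (auto simp: grid_point_def algebra_simps)
        qed
      qed
      then have "\<bar>D u j\<bar> * \<bar>c u j\<bar> \<le> (\<Prod>i\<in>u. step M i) * B u * K u"
        using cK[OF j] by (intro mult_mono) auto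
      then have "\<bar>D u j\<bar> * \<bar>c u j\<bar> * W u j \<le> (\<Prod>i\<in>u. step M i) * B u * K u * W u j"
        using W by (rule mult_right_mono)
      then show ?thesis unfolding split using True W by (simp add: abs_mult mult_ac)
    next
      case False
      \<comment> \<open>At the last node the difference steps out of the box, where \<open>F\<close>
        is not controlled; but there the distribution function is 1 and the kernel factor is
        \<open>1 - 1 = 0\<close>.\<close>
      then obtain i where i: "i \<in> u" "j i = M"
        using j u' by (metis PiE_mem atMost_iff nat_less_le subsetD)
      then have "(\<Prod>i\<in>u. of_bool (y n i \<le> cdf i (a i + real (j i) * step M i))
          - cdf i (a i + real (j i) * step M i)) = 0" if "n < 2 ^ m" for n
        using y[OF that, of i] u' M fin[OF u]
        by (intro prod_zero bexI[of _ i]) (auto simp: node_last cdf_right)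
      then have "c u j = 0" unfolding c_def centred_disc_def by simp
      then show ?thesis unfolding split using \<open>0 \<le> B u\<close> \<open>0 \<le> K u\<close> W u' M
        by (simp add: prod_nonneg less_imp_le step_pos subset_iff)
    qed
    have "\<bar>\<Sum>j\<in>?J. D u j * (c u j * W u j)\<bar> \<le> (\<Sum>j\<in>?J. B u * K u * (\<Prod>i\<in>{1..s}. ?e i (j i)))"
      by (rule order_trans[OF sum_abs sum_mono[OF term_le]])
    also have "\<dots> = B u * K u * (\<Prod>i\<in>{1..s}. \<Sum>t\<le>M. ?e i t)"
      by (subst prod_sum_PiE) (auto simp: sum_distrib_left)
    also have "(\<Prod>i\<in>{1..s}. \<Sum>t\<le>M. ?e i t) = (\<Prod>i\<in>{1..s}. if i \<in> u then b i - a i else 1)"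
    proof (intro prod.cong refl)
      fix i assume i: "i \<in> {1..s}"
      show "(\<Sum>t\<le>M. ?e i t) = (if i \<in> u then b i - a i else 1)"
      proof (cases "i \<in> u")
        case True
        then have "(\<Sum>t\<le>M. ?e i t) = (\<Sum>t<M. step M i)"
          by (simp add: lessThan_Suc_atMost[symmetric])
        also have "\<dots> = b i - a i" using M by (simp add: step_def)
        finally show ?thesis using True by simp
      qed (use weight_total[OF i M] in simp)
    qed
    also have "\<dots> = (\<Prod>i\<in>u. b i - a i)"
      using u' by (simp add: prod.If_cases Int_absorb1)
    finally show ?thesis by (simp add: mult_ac)
  qed
  have "1 / 2 ^ m * (\<Sum>n<2 ^ m. F (round_up M (inv_cdf s a b \<phi> (y n)))) - riemann_sum M F
      = 1 / 2 ^ m * (\<Sum>n<2 ^ m. F (round_up M (inv_cdf s a b \<phi> (y n))) - riemann_sum M F)"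
    by (simp add: sum_subtractf field_simps)
  also have "\<dots> = 1 / 2 ^ m * (\<Sum>n<2 ^ m. \<Sum>u\<in>?U.
      (-1) ^ card u * (\<Sum>j\<in>?J. D u j * ((\<Prod>i\<in>u. \<Sum>r\<le>j i. v n i r) * W u j)))"
  proof (intro arg_cong2[where f = "(*)"] sum.cong[OF refl] refl)
    fix n :: nat assume "n \<in> {..<2 ^ m}"
    then have n: "n < 2 ^ m" by simp
    show "F (round_up M (inv_cdf s a b \<phi> (y n))) - riemann_sum M F = (\<Sum>u\<in>?U.
        (-1) ^ card u * (\<Sum>j\<in>?J. D u j * ((\<Prod>i\<in>u. \<Sum>r\<le>j i. v n i r) * W u j)))"
      unfolding expand[OF n] by (rule sum.cong[OF refl parts[OF n]])
  qed
  also have "\<dots> = (\<Sum>u\<in>?U. (-1) ^ card u *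
      (1 / 2 ^ m * (\<Sum>n<2 ^ m. \<Sum>j\<in>?J. D u j * ((\<Prod>i\<in>u. \<Sum>r\<le>j i. v n i r) * W u j))))"
    by (subst sum.swap) (simp add: sum_distrib_left mult.left_commute)
  also have "\<dots> = (\<Sum>u\<in>?U. (-1) ^ card u * (\<Sum>j\<in>?J. D u j * (c u j * W u j)))"
    by (intro sum.cong refl arg_cong2[where f = "(*)"] average)
  also have "\<bar>\<dots>\<bar> \<le> (\<Sum>u\<in>?U. \<bar>(-1) ^ card u * (\<Sum>j\<in>?J. D u j * (c u j * W u j))\<bar>)"
    by (rule sum_abs)
  also have "\<dots> \<le> (\<Sum>u\<in>?U. B u * ((\<Prod>i\<in>u. b i - a i) * K u))"
    using bound by (intro sum_mono) (simp add: abs_mult power_abs)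
  finally show ?thesis unfolding K_def .
qed

section \<open>Letting the mesh tend to zero\<close>

lemma increment_bound:
  assumes F: "has_mixed_partials s a b F"
    and B: "\<And>i z. i \<in> {1..s} \<Longrightarrow> z \<in> box_on s a b \<Longrightarrow> \<bar>mixed_partial a b {i} F z\<bar> \<le> B i"
    and x: "x \<in> box_on s a b" and z: "z \<in> box_on s a b" and le: "\<And>i. i \<in> {1..s} \<Longrightarrow> x i \<le> z i"
  shows "\<bar>F z - F x\<bar> \<le> (\<Sum>i\<in>{1..s}. B i * (z i - x i))"
proof -
  \<comment> \<open>The path from \<open>x\<close> to \<open>z\<close> changes one coordinate at a
    time; each move is a mixed difference for a singleton, and its starting point stays in the
    box.\<close>
  have "override_on x z T \<in> box_on s a b \<and>
      \<bar>F (override_on x z T) - F x\<bar> \<le> (\<Sum>i\<in>T. B i * (z i - x i))" if "T \<subseteq> {1..s}" "finite T" for T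
    using that(2,1)
  proof (induction T rule: finite_induct)
    case empty
    then show ?case using x by simp
  next
    case (insert k T)
    let ?w = "override_on x z T" and ?h = "\<lambda>i. z i - x i"
    have w: "?w \<in> box_on s a b" "\<bar>F ?w - F x\<bar> \<le> (\<Sum>i\<in>T. B i * (z i - x i))"
      using insert by auto
    have k: "k \<in> {1..s}" "?w k = x k" using insert by auto
    have upd: "override_on x z (insert k T) = ?w(k := z k)"
      by (auto simp: override_on_def fun_eq_iff)
    have "\<bar>foldr (fwd_diff ?h) (sorted_list_of_set {k}) F ?w\<bar> \<le> (\<Prod>i\<in>{k}. ?h i) * B k"
    proof (rule mixed_difference_bound[OF F])
      show "?w i + ?h i \<le> b i" if "i \<in> {k}" for i
        using that k box_onD[OF z k(1)] by auto
    qed (use k w B le in auto)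
    also have "foldr (fwd_diff ?h) (sorted_list_of_set {k}) F ?w = F (?w(k := z k)) - F ?w"
      using k by (simp add: fwd_diff_apply)
    finally have "\<bar>F (?w(k := z k)) - F ?w\<bar> \<le> B k * (z k - x k)" by (simp add: mult.commute)
    moreover have "?w(k := z k) \<in> box_on s a b"
      using w(1) k(1) box_onD[OF z k(1)] by (rule box_on_fun_upd)
    ultimately show ?case
      unfolding upd using w(2) insert.hyps by (simp del: fun_upd_apply)
  qed
  from this[of "{1..s}"] have "\<bar>F (override_on x z {1..s}) - F x\<bar> \<le> (\<Sum>i\<in>{1..s}. B i * (z i - x i))"
    by simp
  moreover have "override_on x z {1..s} = z"
    using x z by (auto simp: override_on_def box_on_def PiE_def extensional_def fun_eq_iff)
  ultimately show ?thesis by simp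
qed

lemma round_up_in_box:
  assumes "0 < M" "x \<in> box_on s a b"
  shows "round_up M x \<in> box_on s a b"
  unfolding round_up_def using assms
  by (intro grid_point_in_box) (auto intro!: cell_le box_onD[OF assms(2)])

text \<open>Bounded first-order partial derivatives make \<open>F\<close> Lipschitz along the
  rounding, which moves coordinate \<open>i\<close> by at most the mesh width.\<close>

lemma eval_round_up_tendsto:
  assumes F: "has_mixed_partials s a b F"
    and B: "\<And>i z. i \<in> {1..s} \<Longrightarrow> z \<in> box_on s a b \<Longrightarrow> \<bar>mixed_partial a b {i} F z\<bar> \<le> B i"
    and x: "x \<in> box_on s a b"
  shows "(\<lambda>n. F (round_up (Suc n) x)) \<longlonglongrightarrow> F x"
proof -
  have bound: "\<bar>F (round_up (Suc n) x) - F x\<bar> \<le> (\<Sum>i\<in>{1..s}. B i * (b i - a i)) / real (Suc n)" for n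
  proof -
    have near: "x i \<le> round_up (Suc n) x i" "round_up (Suc n) x i - x i \<le> step (Suc n) i"
      if "i \<in> {1..s}" for i
      using cell_bounds[of i "Suc n" "x i"] box_onD[OF x that] that
      by (auto simp: round_up_def grid_point_def)
    have B0: "0 \<le> B i" if "i \<in> {1..s}" for i
      using B[OF that x] by linarith
    have "\<bar>F (round_up (Suc n) x) - F x\<bar> \<le> (\<Sum>i\<in>{1..s}. B i * (round_up (Suc n) x i - x i))"
      by (rule increment_bound[OF F B x round_up_in_box[OF _ x]]) (use near in auto)
    also have "\<dots> \<le> (\<Sum>i\<in>{1..s}. B i * step (Suc n) i)"
      using near B0 by (intro sum_mono mult_left_mono) auto
    also have "\<dots> = (\<Sum>i\<in>{1..s}. B i * (b i - a i)) / real (Suc n)"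
      by (simp add: step_def sum_divide_distrib)
    finally show ?thesis .
  qed
  have "(\<lambda>n. (\<Sum>i\<in>{1..s}. B i * (b i - a i)) / real (Suc n)) \<longlonglongrightarrow> 0"
    by (rule LIMSEQ_Suc[OF lim_const_over_n])
  then have "(\<lambda>n. F (round_up (Suc n) x) - F x) \<longlonglongrightarrow> 0"
    by (rule Lim_null_comparison[rotated]) (use bound in simp)
  then show ?thesis by (simp add: LIM_zero_iff)
qed

text \<open>Dominated convergence for the functions \<open>S M\<close>, finite sums of products
  whose integrals are evaluated coordinate by coordinate and add up to the Riemann sum.\<close>

lemma riemann_sum_tendsto:
  assumes F: "has_mixed_partials s a b F"
    and B: "\<And>u z. u \<subseteq> {1..s} \<Longrightarrow> z \<in> box_on s a b \<Longrightarrow> \<bar>mixed_partial a b u F z\<bar> \<le> B u"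
  shows "(\<lambda>n. riemann_sum (Suc n) F) \<longlonglongrightarrow>
    (LINT x:box_on s a b|PiM {1..s} (\<lambda>_. lebesgue). F x * (\<Prod>i\<in>{1..s}. \<phi> i (x i)))"
proof -
  interpret product_sigma_finite "\<lambda>_::nat. lebesgue :: real measure"
    by (simp add: product_sigma_finite_def sigma_finite_lebesgue)
  let ?P = "PiM {1..s} (\<lambda>_. lebesgue :: real measure)"
  let ?J = "\<lambda>M. PiE {1..s} (\<lambda>_. {..M})"
  define g where "g x = (\<Prod>i\<in>{1..s}. dens0 i (x i))" for x
  define f where "f x = indicator (box_on s a b) x * (F x * g x)" for x
  define S where "S M x = (\<Sum>j\<in>?J M. F (grid_point s a (step M) j) *
    (\<Prod>i\<in>{1..s}. dens0 i (x i) * indicator {x. cell M i x = j i} (x i)))" for M x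
  have g0: "g x = 0" if "x \<in> space ?P" "x \<notin> box_on s a b" for x
  proof -
    have "\<not> (\<forall>i\<in>{1..s}. x i \<in> {a i..b i})"
      using that by (auto simp: space_PiM box_on_def PiE_iff)
    then obtain i where "i \<in> {1..s}" "x i \<notin> {a i..b i}" by blast
    then show ?thesis unfolding g_def
      by (intro prod_zero bexI[of _ i]) (auto simp: dens0_def)
  qed
  have g_nonneg: "0 \<le> g x" for x
    unfolding g_def by (intro prod_nonneg) (simp add: dens0_nonneg)
  have S_eq: "S (Suc n) x = indicator (box_on s a b) x * (F (round_up (Suc n) x) * g x)"
    if "x \<in> space ?P" for n x
  proof -
    have prod: "(\<Prod>i\<in>{1..s}. dens0 i (x i) * indicator {x. cell (Suc n) i x = j i} (x i))
        = (\<Prod>i\<in>{1..s}. of_bool (j i = cell (Suc n) i (x i))) * g x" for j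
    proof -
      have "indicator {x. cell (Suc n) i x = j i} (x i) = (of_bool (j i = cell (Suc n) i (x i)) :: real)" for i
        by (auto simp: indicator_def)
      then show ?thesis by (simp only: g_def prod.distrib mult.commute)
    qed
    have "S (Suc n) x = (\<Sum>j\<in>?J (Suc n). F (grid_point s a (step (Suc n)) j) *
        (\<Prod>i\<in>{1..s}. of_bool (j i = cell (Suc n) i (x i)))) * g x"
      unfolding S_def prod sum_distrib_right by (simp only: mult.assoc)
    then show ?thesis
      using eval_round_up[of "Suc n" x F] g0[OF that] by (cases "x \<in> box_on s a b") auto
  qed
  have int_prod: "integrable ?P (\<lambda>x. \<Prod>i\<in>{1..s}. dens0 i (x i) * indicator {x. cell M i x = j i} (x i))" for M j
    by (intro product_integrable_prod weight_integrable) auto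
  have S_int: "integral\<^sup>L ?P (S M) = riemann_sum M F" for M
  proof -
    have "integral\<^sup>L ?P (S M) = (\<Sum>j\<in>?J M. \<integral>x. F (grid_point s a (step M) j) *
      (\<Prod>i\<in>{1..s}. dens0 i (x i) * indicator {x. cell M i x = j i} (x i)) \<partial>?P)"
      unfolding S_def[abs_def]
      by (intro Bochner_Integration.integral_sum integrable_mult_right int_prod)
    also have "\<dots> = riemann_sum M F"
      unfolding riemann_sum_def weight_def
      by (intro sum.cong refl) (subst product_integral_prod[symmetric], auto intro: weight_integrable)
    finally show ?thesis .
  qed
  have S_meas: "S M \<in> borel_measurable ?P" for M
    unfolding S_def[abs_def]
    by (intro borel_measurable_sum borel_measurable_times borel_measurable_const
        borel_measurable_integrable[OF int_prod])
  have lim: "(\<lambda>n. S (Suc n) x) \<longlonglongrightarrow> f x" if "x \<in> space ?P" for x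
  proof (cases "x \<in> box_on s a b")
    case True
    have "(\<lambda>n. F (round_up (Suc n) x)) \<longlonglongrightarrow> F x"
    proof (rule eval_round_up_tendsto[OF F _ True, where B = "\<lambda>i. B {i}"])
      show "\<bar>mixed_partial a b {i} F z\<bar> \<le> B {i}" if "i \<in> {1..s}" "z \<in> box_on s a b" for i z
        using that by (intro B) auto
    qed
    then show ?thesis
      unfolding S_eq[OF that] f_def by (intro tendsto_intros)
  qed (simp add: S_eq[OF that] f_def)
  have "(\<lambda>n. integral\<^sup>L ?P (S (Suc n))) \<longlonglongrightarrow> integral\<^sup>L ?P f"
  \<comment> \<open>The bound for the empty set of directions controls \<open>F\<close> itself, so a
    multiple of the product density dominates.\<close>
  proof (rule integral_dominated_convergence[where w = "\<lambda>x. B {} * g x"])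
    show "f \<in> borel_measurable ?P"
      \<comment> \<open>Measurability of the integrand is inherited from \<open>S\<close>, which
        uses \<open>F\<close> only through its values at finitely many nodes.\<close>
      by (rule borel_measurable_LIMSEQ_real[OF lim S_meas])
    show "integrable ?P (\<lambda>x. B {} * g x)"
      unfolding g_def by (intro integrable_mult_right product_integrable_prod dens0_integrable) auto
    show "AE x in ?P. norm (S (Suc n) x) \<le> B {} * g x" for n
    proof (rule AE_I2)
      fix x assume x: "x \<in> space ?P"
      show "norm (S (Suc n) x) \<le> B {} * g x"
      proof (cases "x \<in> box_on s a b")
        case True
        have "\<bar>F (round_up (Suc n) x)\<bar> \<le> B {}"
          using B[of "{}" "round_up (Suc n) x"] round_up_in_box[OF _ True] by (simp add: mixed_partial_def)
        then show ?thesis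
          using True g_nonneg by (simp add: S_eq[OF x] abs_mult mult_right_mono)
      qed (simp add: S_eq[OF x] g0[OF x])
    qed
    show "AE x in ?P. (\<lambda>n. S (Suc n) x) \<longlonglongrightarrow> f x"
      by (rule AE_I2) (rule lim)
  qed (rule S_meas)
  moreover have "integral\<^sup>L ?P f = (LINT x:box_on s a b|?P. F x * (\<Prod>i\<in>{1..s}. \<phi> i (x i)))"
    unfolding set_lebesgue_integral_def
  proof (intro Bochner_Integration.integral_cong refl)
    fix x
    have "g x = (\<Prod>i\<in>{1..s}. \<phi> i (x i))" if "x \<in> box_on s a b"
      unfolding g_def using box_onD[OF that] by (intro prod.cong) (auto simp: dens0_def)
    then show "f x = indicat_real (box_on s a b) x *\<^sub>R (F x * (\<Prod>i\<in>{1..s}. \<phi> i (x i)))"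
      by (auto simp: f_def indicator_def)
  qed
  ultimately show ?thesis by (simp only: S_int)
qed

text \<open>The bound for fixed mesh does not depend on \<open>M\<close>, so it survives the
  limit.\<close>

lemma qmc_err_bound:
  assumes F: "has_mixed_partials s a b F" and reg: "projection_regular s m y"
    and B: "\<And>u z. u \<subseteq> {1..s} \<Longrightarrow> z \<in> box_on s a b \<Longrightarrow> \<bar>mixed_partial a b u F z\<bar> \<le> B u"
  shows "\<bar>qmc_err s a b \<phi> (2 ^ m) y F\<bar>
    \<le> (\<Sum>u\<in>Pow {1..s} - {{}}. B u * ((\<Prod>i\<in>u. b i - a i) * (2 ^ card u / 2 ^ m + walsh_sum m y u)))"
    (is "_ \<le> ?R")
proof -
  have box: "inv_cdf s a b \<phi> (y n) \<in> box_on s a b" if "n < 2 ^ m" for n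
  proof (rule inv_cdf_in_box)
    fix i assume "i \<in> {1..s}"
    moreover have "y n \<in> (\<Pi>\<^sub>E i\<in>{1..s}. {0..<1})"
      using reg that unfolding projection_regular_def by blast
    ultimately have "y n i \<in> {0..<1}" by (rule PiE_mem[rotated])
    then show "y n i \<in> {0..1}" by simp
  qed
  let ?e = "\<lambda>k. 1 / 2 ^ m * (\<Sum>n<2 ^ m. F (round_up (Suc k) (inv_cdf s a b \<phi> (y n)))) - riemann_sum (Suc k) F"
  have "(\<lambda>k. F (round_up (Suc k) (inv_cdf s a b \<phi> (y n)))) \<longlonglongrightarrow> F (inv_cdf s a b \<phi> (y n))"
    if "n < 2 ^ m" for n
  proof (rule eval_round_up_tendsto[OF F, where B = "\<lambda>i. B {i}"])
    show "\<bar>mixed_partial a b {i} F z\<bar> \<le> B {i}" if "i \<in> {1..s}" "z \<in> box_on s a b" for i z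
      using that by (intro B) auto
  qed (rule box[OF that])
  moreover note riemann_sum_tendsto[OF F B]
  ultimately have "?e \<longlonglongrightarrow> 1 / 2 ^ m * (\<Sum>n<2 ^ m. F (inv_cdf s a b \<phi> (y n)))
      - (LINT x:box_on s a b|PiM {1..s} (\<lambda>_. lebesgue). F x * (\<Prod>i\<in>{1..s}. \<phi> i (x i)))"
    by (intro tendsto_diff tendsto_mult tendsto_const tendsto_sum) simp_all
  then have "?e \<longlonglongrightarrow> qmc_err s a b \<phi> (2 ^ m) y F"
    by (simp add: qmc_err_def)
  then have "(\<lambda>k. \<bar>?e k\<bar>) \<longlonglongrightarrow> \<bar>qmc_err s a b \<phi> (2 ^ m) y F\<bar>"
    by (rule tendsto_rabs)
  then show ?thesis
    by (rule LIMSEQ_le_const2) (intro exI[of _ 0] allI impI discrete_error_bound[OF F reg zero_less_Suc B])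
qed

end

section \<open>Hoelder's inequality and the main theorem\<close>

text \<open>Young's inequality termwise, after dividing \<open>z\<close> by its
  \<open>q\<close>-norm \<open>Z\<close>; the case of vanishing \<open>z\<close> is
  separate.\<close>

lemma Holder_inequality_sum:
  fixes x z :: "'a \<Rightarrow> real" and p q :: real
  assumes p: "1 < p" "1 < q" "1 / p + 1 / q = 1" and fin: "finite U"
    and nonneg: "\<And>u. u \<in> U \<Longrightarrow> 0 \<le> x u" "\<And>u. u \<in> U \<Longrightarrow> 0 \<le> z u"
    and x: "(\<Sum>u\<in>U. x u powr p) \<le> 1"
  shows "(\<Sum>u\<in>U. x u * z u) \<le> (\<Sum>u\<in>U. z u powr q) powr (1 / q)"
proof -
  define Z where "Z = (\<Sum>u\<in>U. z u powr q) powr (1 / q)"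
  have sum_nonneg: "0 \<le> (\<Sum>u\<in>U. z u powr q)" by (intro sum_nonneg) simp
  show ?thesis
  proof (cases "(\<Sum>u\<in>U. z u powr q) = 0")
    case True
    then have "z u = 0" if "u \<in> U" for u using that fin by (simp add: sum_nonneg_eq_0_iff)
    then show ?thesis by simp
  next
    case False
    then have "0 < Z" unfolding Z_def by simp
    have Zq: "Z powr q = (\<Sum>u\<in>U. z u powr q)"
      unfolding Z_def using p sum_nonneg by (simp add: powr_powr)
    have "(\<Sum>u\<in>U. x u * (z u / Z)) \<le> (\<Sum>u\<in>U. x u powr p / p + (z u / Z) powr q / q)"
      using nonneg \<open>0 < Z\<close> p by (intro sum_mono Youngs_inequality) auto
    also have "\<dots> = (\<Sum>u\<in>U. x u powr p) / p + (\<Sum>u\<in>U. z u powr q) / Z powr q / q"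
      using nonneg \<open>0 < Z\<close>
      by (simp add: sum.distrib sum_divide_distrib powr_divide)
    also have "\<dots> \<le> 1 / p + 1 / q"
      using divide_right_mono[OF x, of p] p False unfolding Zq by simp
    finally have "(\<Sum>u\<in>U. x u * z u) / Z \<le> 1"
      using p by (simp add: sum_divide_distrib)
    then show ?thesis using \<open>0 < Z\<close> unfolding Z_def by (simp add: field_simps)
  qed
qed

text \<open>Since \<open>1 / \<infinity> = 0\<close>, an infinite exponent forces the conjugate one
  to be 1, and the two extreme cases are direct estimates.\<close>

lemma Holder_inequality_sum_ereal:
  fixes x z :: "'a \<Rightarrow> real" and p q :: ereal
  assumes pq: "1 \<le> p" "1 \<le> q" "1 / p + 1 / q = 1" and U: "finite U" "U \<noteq> {}"
    and nonneg: "\<And>u. u \<in> U \<Longrightarrow> 0 \<le> x u" "\<And>u. u \<in> U \<Longrightarrow> 0 \<le> z u"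
    and x_sup: "p = \<infinity> \<Longrightarrow> (\<And>u. u \<in> U \<Longrightarrow> x u \<le> 1)"
    and x_sum: "p \<noteq> \<infinity> \<Longrightarrow> (\<Sum>u\<in>U. x u powr real_of_ereal p) \<le> 1"
  shows "(\<Sum>u\<in>U. x u * z u) \<le>
    (if q = \<infinity> then Max (z ` U) else (\<Sum>u\<in>U. z u powr real_of_ereal q) powr (1 / real_of_ereal q))"
proof (cases p)
  case PInf
  then have "1 / q = 1" using pq by simp
  then have q: "q = 1" using pq by (cases q) (auto simp: one_ereal_def)
  have "(\<Sum>u\<in>U. x u * z u) \<le> (\<Sum>u\<in>U. z u)"
    using x_sup PInf nonneg by (intro sum_mono) (simp add: mult_left_le_one_le)
  also have "\<dots> = (\<Sum>u\<in>U. z u powr 1)" using nonneg by simp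
  also have "\<dots> = (\<Sum>u\<in>U. z u powr 1) powr (1 / 1)" by (simp add: sum_nonneg)
  finally show ?thesis by (simp add: q)
next
  case (real r)
  show ?thesis
  proof (cases q)
    case PInf
    then have "r = 1" using pq real by (auto simp: one_ereal_def)
    have "(\<Sum>u\<in>U. x u * z u) \<le> (\<Sum>u\<in>U. x u * Max (z ` U))"
      using nonneg U by (intro sum_mono mult_left_mono) auto
    also have "\<dots> = (\<Sum>u\<in>U. x u powr real_of_ereal p) * Max (z ` U)"
      using nonneg by (simp add: sum_distrib_right real \<open>r = 1\<close>)
    also have "\<dots> \<le> 1 * Max (z ` U)"
    proof (rule mult_right_mono)
      show "(\<Sum>u\<in>U. x u powr real_of_ereal p) \<le> 1" using x_sum real by simp
      obtain u where "u \<in> U" using U by blast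
      then show "0 \<le> Max (z ` U)" using nonneg(2)[of u] U(1) by (meson Max_ge finite_imageI image_eqI order_trans)
    qed
    finally show ?thesis using PInf by simp
  next
    case q: (real t)
    have rt: "1 \<le> r" "1 \<le> t" "1 / r + 1 / t = 1"
      using pq real q by (auto simp: one_ereal_def)
    have "r \<noteq> 1" "t \<noteq> 1" using rt by auto
    then have "1 < r" "1 < t" using rt by auto
    then show ?thesis
      using Holder_inequality_sum[OF \<open>1 < r\<close> \<open>1 < t\<close> rt(3) U(1) nonneg] x_sum real q by simp
  qed (use pq in auto)
qed (use pq in auto)

lemma walsh_sum_nonneg: "0 \<le> walsh_sum m y u"
  unfolding walsh_sum_def by (intro sum_nonneg) simp

theorem theorem1:
  fixes s m :: nat and a b :: "nat \<Rightarrow> real" and \<phi> :: "nat \<Rightarrow> real \<Rightarrow> real"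
    and \<gamma> :: "nat set \<Rightarrow> real" and y :: "nat \<Rightarrow> nat \<Rightarrow> real" and p q :: ereal
  assumes "1 \<le> s" and "1 \<le> m"
    and "\<And>i. i \<in> {1..s} \<Longrightarrow> a i < b i"
    and "\<And>i. i \<in> {1..s} \<Longrightarrow> prob_density_on (a i) (b i) (\<phi> i)"
    and "\<And>i. i \<in> {1..s} \<Longrightarrow> bij_betw (cdf_on (a i) (\<phi> i)) {a i..b i} {0..1}"
    and "\<And>u. u \<subseteq> {1..s} \<Longrightarrow> 0 < \<gamma> u"
    and "projection_regular s m y"
    and "1 \<le> p" and "1 \<le> q" and "1 / p + 1 / q = 1"
  shows "wce (2 ^ m) y p s \<gamma> a b \<phi> \<le>
    ereal (if q = \<infinity>
      then (MAX u\<in>Pow {1..s} - {{}}.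
              \<gamma> u * (\<Prod>i\<in>u. b i - a i) * (2 ^ card u / 2 ^ m + walsh_sum m y u))
      else (\<Sum>u\<in>Pow {1..s} - {{}}.
              \<gamma> u powr real_of_ereal q * (\<Prod>i\<in>u. (b i - a i) powr real_of_ereal q) *
              (2 ^ card u / 2 ^ m + walsh_sum m y u) powr real_of_ereal q)
            powr (1 / real_of_ereal q))"
  (is "_ \<le> ereal ?R")
proof -
  interpret density_box s a b \<phi>
    using assms(3-5) by unfold_locales
  let ?U = "Pow {1..s} - {{}} :: nat set set"
  define K where "K u = 2 ^ card u / 2 ^ m + walsh_sum m y u" for u
  define z where "z u = \<gamma> u * (\<Prod>i\<in>u. b i - a i) * K u" for u
  \<comment> \<open>With \<open>1 \<le> s\<close> the maximum for \<open>q = \<infinity>\<close> is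
    over a nonempty set.\<close>
  have U: "finite ?U" "?U \<noteq> {}" using assms(1) by auto
  have K: "0 \<le> K u" for u unfolding K_def using walsh_sum_nonneg by simp
  have len: "0 \<le> (\<Prod>i\<in>u. b i - a i)" if "u \<in> ?U" for u
    using that less by (intro prod_nonneg) (auto simp: less_imp_le subset_iff)
  have z: "0 \<le> z u" if "u \<in> ?U" for u
    unfolding z_def using that assms(6)[of u] K len[OF that] by (simp add: less_imp_le)
  have zq: "z u powr t = \<gamma> u powr t * (\<Prod>i\<in>u. (b i - a i) powr t) * K u powr t" if "u \<in> ?U" for u t
  proof -
    have "(\<Prod>i\<in>u. b i - a i) powr t = (\<Prod>i\<in>u. (b i - a i) powr t)"
      by (rule prod_powr_distrib)
    then show ?thesis
      unfolding z_def using assms(6)[of u] that K len[OF that] by (simp add: powr_mult less_imp_le)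
  qed
  have zsum: "(\<Sum>u\<in>?U. z u powr t) = (\<Sum>u\<in>?U. \<gamma> u powr t * (\<Prod>i\<in>u. (b i - a i) powr t) * K u powr t)" for t
    by (rule sum.cong[OF refl zq])
  have R: "?R = (if q = \<infinity> then Max (z ` ?U)
      else (\<Sum>u\<in>?U. z u powr real_of_ereal q) powr (1 / real_of_ereal q))"
    unfolding zsum unfolding z_def[abs_def] K_def ..
  show ?thesis
    unfolding wce_def
  proof (rule SUP_least)
    fix F assume "F \<in> {F. has_mixed_partials s a b F \<and> mixed_norm p s \<gamma> a b F \<le> 1}"
    then have F: "has_mixed_partials s a b F" and norm: "mixed_norm p s \<gamma> a b F \<le> 1" by auto
    define B where "B u = sup_mixed_partial s a b u F" for u
    \<comment> \<open>The norm of \<open>F\<close> is the \<open>p\<close>-norm of \<open>x\<close>.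
      The factor \<open>1 / \<gamma> u\<close> cancels against the one in \<open>z u\<close>, which
      turns the error bound into a pairing of \<open>x\<close> and \<open>z\<close>.\<close>
    define x where "x u = 1 / \<gamma> u * B u" for u
    \<comment> \<open>A norm of at most 1 excludes the infinite branch, so the suprema are genuine
      bounds.\<close>
    have bdd: "bdd_above ((\<lambda>x. \<bar>mixed_partial a b u F x\<bar>) ` box_on s a b)" if "u \<subseteq> {1..s}" for u
      using norm that unfolding mixed_norm_def by (auto split: if_splits)
    then have B: "\<bar>mixed_partial a b u F w\<bar> \<le> B u" if "u \<subseteq> {1..s}" "w \<in> box_on s a b" for u w
      unfolding B_def sup_mixed_partial_def using that by (intro cSUP_upper) auto
    have x: "0 \<le> x u" if "u \<subseteq> {1..s}" for u
    proof -
      have "(\<lambda>i\<in>{1..s}. a i) \<in> box_on s a b" using less by (auto simp: box_on_def less_imp_le)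
      from B[OF that this] have "0 \<le> B u" by linarith
      then show ?thesis unfolding x_def using assms(6)[OF that] by simp
    qed
    have norm': "(if p = \<infinity> then (MAX u\<in>Pow {1..s}. x u)
        else (\<Sum>u\<in>Pow {1..s}. x u powr real_of_ereal p) powr (1 / real_of_ereal p)) \<le> 1"
      using norm bdd unfolding mixed_norm_def x_def B_def by (auto simp: one_ereal_def split: if_splits)
    have "\<bar>qmc_err s a b \<phi> (2 ^ m) y F\<bar> \<le> (\<Sum>u\<in>?U. B u * ((\<Prod>i\<in>u. b i - a i) * K u))"
      unfolding K_def by (rule qmc_err_bound[OF F assms(7) B])
    also have "\<dots> = (\<Sum>u\<in>?U. x u * z u)"
      using assms(6) by (intro sum.cong refl) (simp add: x_def z_def less_imp_neq[symmetric])
    also have "\<dots> \<le> ?R"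
      unfolding R
    proof (rule Holder_inequality_sum_ereal[OF assms(8-10) U])
      show "x u \<le> 1" if "p = \<infinity>" "u \<in> ?U" for u
        using norm' that by (auto dest: Max_le_iff[THEN iffD1, rotated 2])
      show "(\<Sum>u\<in>?U. x u powr real_of_ereal p) \<le> 1" if "p \<noteq> \<infinity>"
      proof -
        have p: "0 < real_of_ereal p" using that assms(8) by (cases p) (auto simp: one_ereal_def)
        have "(\<Sum>u\<in>Pow {1..s}. x u powr real_of_ereal p) \<le> 1"
        proof (rule ccontr)
          \<comment> \<open>The power \<open>1 / p\<close> keeps a number above 1 above 1, so the
            norm bound is a bound on the sum of powers.\<close>
          assume "\<not> ?thesis"
          then have "1 < (\<Sum>u\<in>Pow {1..s}. x u powr real_of_ereal p) powr (1 / real_of_ereal p)"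
            using p by (intro gr_one_powr) auto
          then show False using norm' that by simp
        qed
        \<comment> \<open>The error has no component for the empty set, and its nonnegative term in
          the norm is dropped.\<close>
        moreover have "(\<Sum>u\<in>?U. x u powr real_of_ereal p) \<le> (\<Sum>u\<in>Pow {1..s}. x u powr real_of_ereal p)"
          by (intro sum_mono2) auto
        ultimately show ?thesis by linarith
      qed
    qed (use x z in auto)
    finally show "ereal \<bar>qmc_err s a b \<phi> (2 ^ m) y F\<bar> \<le> ereal ?R" by simp
  qed
qed

end
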